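(* For every integer $t\ge 1$ there exists a constant $c_t$, depending only on $t$, such that the following holds for every $\epsilon>0$ and every positive integer $n$. Let $F$ be a simple family of $n$ $t$-monotone curves in the plane with at least $\epsilon n^2$ intersecting (unordered) pairs. Then there exist two subfamilies $F_1,F_2\subset F$ such that $|F_1|,|F_2|\ge \epsilon^{c_t} n$ and every curve in $F_1$ intersects every curve in $F_2$.
   Context: A curve in the plane is the image of a smooth injective function $f:I\to\mathbb{R}^2$ whose domain is a closed (bounded) interval $I\subset\mathbb{R}$; smooth is understood as regular (nowhere vanishing derivative), so that the curve has a tangent line at each point. The two images of the endpoints of $I$ are the endpoints of the curve, and the remaining points form its interior. For an integer $t\ge 1$, a curve is $t$-monotone if its interior has at most $t-1$ points at which the tangent is vertical. A family $F$ of curves is simple if any two distinct members intersect in at most one point and no two curves are tangent, i.e., if two curves have a common interior point, they must properly cross at that point. Two curves intersect if they have a point in common. *)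

theory Defs
  imports "HOL-Analysis.Analysis"
begin

text \<open>Curves are point sets in the plane. A parametrization is injective and regular of class
  \<open>C\<^sup>1\<close>, with one-sided derivatives at the ends of the parameter interval; more highly
  differentiable regular curves are included. Values of \<open>f\<close> outside \<open>{a..b}\<close> are irrelevant.\<close>

definition parametrizes :: "real \<Rightarrow> real \<Rightarrow> (real \<Rightarrow> real ^ 2) \<Rightarrow> (real ^ 2) set \<Rightarrow> bool" where
  "parametrizes a b f C \<longleftrightarrow>
     a < b \<and> inj_on f {a..b} \<and> f ` {a..b} = C \<and>
     (\<exists>f'. continuous_on {a..b} f' \<and>
       (\<forall>s\<in>{a..b}. (f has_vector_derivative f' s) (at s within {a..b}) \<and> f' s \<noteq> 0))"

definition curve :: "(real ^ 2) set \<Rightarrow> bool" where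
  "curve C \<longleftrightarrow> (\<exists>a b f. parametrizes a b f C)"

text \<open>The endpoints, and the tangent direction at a point, are the same for all
  parametrizations of a curve, so the existential quantifiers in the next two definitions could
  equally be universal ones.\<close>

definition curve_interior :: "(real ^ 2) set \<Rightarrow> (real ^ 2) set" where
  "curve_interior C = {p. \<exists>a b f. parametrizes a b f C \<and> p \<in> f ` {a<..<b}}"

definition vertical_tangent_at :: "(real ^ 2) set \<Rightarrow> real ^ 2 \<Rightarrow> bool" where
  "vertical_tangent_at C p \<longleftrightarrow>
     (\<exists>a b f s. parametrizes a b f C \<and> s \<in> {a..b} \<and> f s = p \<and>
       vector_derivative f (at s within {a..b}) $ 1 = 0)"

definition t_monotone :: "nat \<Rightarrow> (real ^ 2) set \<Rightarrow> bool" where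
  "t_monotone t C \<longleftrightarrow>
     curve C \<and>
     finite {p \<in> curve_interior C. vertical_tangent_at C p} \<and>
     card {p \<in> curve_interior C. vertical_tangent_at C p} \<le> t - 1"

text \<open>A proper crossing is understood topologically: near \<open>p\<close> the two curves look, up to
  homeomorphism, like the two coordinate axes near the origin, so that each passes from one side
  of the other to the opposite side. A transversal intersection of interior points is a proper
  crossing, and so is that of \<open>y = 0\<close> and \<open>y = x\<^sup>3\<close> at the origin; that of \<open>y = 0\<close> and
  \<open>y = x\<^sup>2\<close> is not.\<close>

definition properly_cross_at :: "(real ^ 2) set \<Rightarrow> (real ^ 2) set \<Rightarrow> real ^ 2 \<Rightarrow> bool" where
  "properly_cross_at A B p \<longleftrightarrow>
     (\<exists>(U :: (real ^ 2) set) (V :: (real ^ 2) set) g h.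
       open U \<and> open V \<and> p \<in> U \<and> homeomorphism U V g h \<and> g p = 0 \<and>
       g ` (A \<inter> U) = {v \<in> V. v $ 2 = 0} \<and>
       g ` (B \<inter> U) = {v \<in> V. v $ 1 = 0})"

definition simple_family :: "(real ^ 2) set set \<Rightarrow> bool" where
  "simple_family F \<longleftrightarrow>
     (\<forall>A\<in>F. \<forall>B\<in>F. A \<noteq> B \<longrightarrow>
       (\<forall>p\<in>A \<inter> B. \<forall>q\<in>A \<inter> B. p = q) \<and>
       (\<forall>p\<in>curve_interior A \<inter> curve_interior B. properly_cross_at A B p))"

definition curves_intersect :: "(real ^ 2) set \<Rightarrow> (real ^ 2) set \<Rightarrow> bool" where
  "curves_intersect A B \<longleftrightarrow> A \<inter> B \<noteq> {}"

definition intersecting_pairs :: "(real ^ 2) set set \<Rightarrow> (real ^ 2) set set set" where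
  "intersecting_pairs F = {{A, B} | A B. A \<in> F \<and> B \<in> F \<and> A \<noteq> B \<and> curves_intersect A B}"

end

theory Submission
  imports Defs
begin

text \<open>Cut at its vertical tangents, a \<open>t\<close>-monotone curve becomes the union of at most \<open>t\<close> graphs of
  continuous functions on compact intervals (\<open>monotone_decomposition\<close>). Hence, for some indices
  \<open>i, j < t\<close>, at least \<open>\<epsilon> n\<^sup>2 / t\<^sup>2\<close> ordered pairs of curves meet in the \<open>i\<close>-th piece of the first
  and the \<open>j\<close>-th piece of the second, and only these two families of graphs matter from then on.

  Two graphs can meet only if their domains have a common interval \<open>[u, v]\<close>, and then it can be
  read off at \<open>u\<close> and \<open>v\<close> whether they do. If they differ strictly and in the same sense at \<open>u\<close> and at \<open>v\<close>, a unique common point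
  would be one where they touch, and a proper crossing excludes that
  (\<open>meeting_pieces_interlaced\<close>); in all other cases they meet by the intermediate value theorem.
  Since \<open>u\<close> and \<open>v\<close> are endpoints of the two domains, the relation between two graphs depends only
  on the position of the endpoints of each of them with respect to the other.

  The position of points with respect to graphs admits a cutting (\<open>cutting_exists\<close>): the plane is divided into a number of cells polynomial in \<open>1 / \<delta>\<close>, such that
  all points of a cell have the same position with respect to all but a fraction \<open>\<delta>\<close> of the graphs.
  The cells are those of the vertical slab decomposition of a random sample of the graphs. Every
  cell is described by six members of the sample and crossed by none; a cell crossed by many graphs
  is unlikely to be avoided by the rest of the sample. Six members suffice because two graphs cross
  at most once, so that two graphs determine the abscissa of a crossing.

  Take cuttings for both families with \<open>\<delta>\<close> proportional to \<open>\<epsilon>\<close>, and classify each graph by the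
  cells of the other cutting that contain its two endpoints. For most of the meeting pairs
  \<open>(a, b)\<close>, all members of the class of \<open>a\<close> have endpoints in the same position with respect to \<open>b\<close>,
  and vice versa. A pigeonhole argument over classes and positions turns these pairs into a large
  rectangle on which all positions agree (\<open>homogeneous_rectangle\<close>), so that all its pairs meet. The
  loss is a constant times a fixed power of \<open>\<epsilon>\<close>, and constants can be absorbed into the exponent
  because \<open>\<epsilon> \<le> 1 / 2\<close>.\<close>

section \<open>Random samples\<close>

text \<open>Draw the \<open>s\<close> members of the sample independently from \<open>B\<close>, and fix the \<open>k\<close> places of the sample
  that describe a cell. The remaining \<open>s - k\<close> members are independent of the cell, so if more than
  \<open>\<delta> * card B\<close> elements cross it, all of them avoid it with probability at most
  \<open>(1 - \<delta>) ^ (s - k)\<close>. The union bound runs over flags and places; summing over all cells that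
  elements of \<open>B\<close> can describe would instead make \<open>s\<close> depend on \<open>card B\<close>.\<close>
lemma representative_sample:
  fixes B :: "'b set" and crosses :: "'d \<Rightarrow> 'b list \<Rightarrow> 'b \<Rightarrow> bool" and \<delta> :: real
  assumes "finite B" "B \<noteq> {}" "finite D" "0 < \<delta>" "\<delta> \<le> 1" "k \<le> s"
    and small: "real (card D) * real s ^ k * (1 - \<delta>) ^ (s - k) < 1"
  obtains \<omega> where "\<And>i. i < s \<Longrightarrow> \<omega> i \<in> B"
    and "\<And>d ps. d \<in> D \<Longrightarrow> set ps \<subseteq> {..<s} \<Longrightarrow> length ps = k \<Longrightarrow>
           (\<And>i. i < s \<Longrightarrow> \<not> crosses d (map \<omega> ps) (\<omega> i)) \<Longrightarrow>
           real (card {b \<in> B. crosses d (map \<omega> ps) b}) \<le> \<delta> * real (card B)"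
proof -
  define m where "m = card B"
  define \<Omega> where "\<Omega> = {..<s} \<rightarrow>\<^sub>E B"
  define Is where "Is = {ps. set ps \<subseteq> {..<s} \<and> length ps = k}"
  define heavy where "heavy d bs \<longleftrightarrow> real (card {b \<in> B. crosses d bs b}) > \<delta> * real m" for d bs
  define bad where
    "bad d ps = {\<omega> \<in> \<Omega>. heavy d (map \<omega> ps) \<and> (\<forall>i<s. \<not> crosses d (map \<omega> ps) (\<omega> i))}" for d ps
  have m: "m > 0" using assms by (simp add: m_def card_gt_0_iff)
  have fin\<Omega>: "finite \<Omega>" and card\<Omega>: "card \<Omega> = m ^ s"
    using assms by (simp_all add: \<Omega>_def finite_PiE card_PiE m_def)
  have finIs: "finite Is" and cardIs: "card Is = s ^ k"
    using finite_lists_length_eq[of "{..<s}" k] card_lists_length_eq[of "{..<s}" k]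
    by (simp_all add: Is_def)
  have bad_le: "real (card (bad d ps)) \<le> real m ^ s * (1 - \<delta>) ^ (s - k)" if "ps \<in> Is" for d  ps
  proof -
    define J where "J = set ps"
    have J: "finite J" "J \<subseteq> {..<s}" "card J \<le> k"
      using that card_length[of  ps] by (auto simp: J_def Is_def)
    define free where "free \<rho> = (if heavy d (map \<rho> ps)
      then ({..<s} - J) \<rightarrow>\<^sub>E {b \<in> B. \<not> crosses d (map \<rho> ps) b} else {})" for \<rho>
    define split where "split \<omega> = (restrict \<omega> J, restrict \<omega> ({..<s} - J))" for \<omega> :: "nat \<Rightarrow> 'b"
    (* The values on J determine the cell; the values off J are then chosen freely among the
       elements that do not cross it. *)
    have inj: "inj_on split (bad d ps)"
    proof (rule inj_onI)
      fix \<omega> \<omega>' assume *: "\<omega> \<in> bad d ps" "\<omega>' \<in> bad d ps" "split \<omega> = split \<omega>'"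
      have "\<omega> i = \<omega>' i" for i
      proof (cases "i < s")
        case True
        then show ?thesis using *(3) unfolding split_def
          by (cases "i \<in> J") (auto simp: restrict_def fun_eq_iff split: if_splits)
      next
        case False
        then show ?thesis using * by (auto simp: bad_def \<Omega>_def PiE_def extensional_def)
      qed
      then show "\<omega> = \<omega>'" by blast
    qed
    have same: "map (restrict \<omega> J) ps = map \<omega> ps" for \<omega> :: "nat \<Rightarrow> 'b"
      by (simp add: J_def)
    have finfree: "finite (free \<rho>)" for \<rho>
      using assms J by (simp add: free_def finite_PiE)
    have "split ` bad d ps \<subseteq> Sigma (J \<rightarrow>\<^sub>E B) free"
      using J by (auto simp: bad_def split_def free_def same \<Omega>_def)
    moreover have fin: "finite (Sigma (J \<rightarrow>\<^sub>E B) free)"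
      using assms J finfree by (intro finite_SigmaI finite_PiE) auto
    ultimately have "card (bad d ps) \<le> card (Sigma (J \<rightarrow>\<^sub>E B) free)"
      using inj by (metis card_image card_mono)
    also have "\<dots> = (\<Sum>\<rho>\<in>J \<rightarrow>\<^sub>E B. card (free \<rho>))"
      using assms J finfree by (subst card_SigmaI) (auto intro!: finite_PiE)
    finally have "real (card (bad d ps)) \<le> (\<Sum>\<rho>\<in>J \<rightarrow>\<^sub>E B. real (card (free \<rho>)))"
      by (metis of_nat_le_iff of_nat_sum)
    also have "\<dots> \<le> (\<Sum>\<rho>\<in>J \<rightarrow>\<^sub>E B. ((1 - \<delta>) * real m) ^ (s - card J))"
    proof (rule sum_mono)
      fix \<rho>
      show "real (card (free \<rho>)) \<le> ((1 - \<delta>) * real m) ^ (s - card J)"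
      proof (cases "heavy d (map \<rho> ps)")
        case True
        let ?X = "{b \<in> B. crosses d (map \<rho> ps) b}"
        have "{b \<in> B. \<not> crosses d (map \<rho> ps) b} = B - ?X" by auto
        then have "card {b \<in> B. \<not> crosses d (map \<rho> ps) b} = m - card ?X"
          using assms by (simp add: card_Diff_subset m_def)
        moreover have "card ?X \<le> m" using assms by (auto simp: m_def intro: card_mono)
        ultimately have "real (card {b \<in> B. \<not> crosses d (map \<rho> ps) b}) \<le> (1 - \<delta>) * real m"
          using True by (simp add: heavy_def algebra_simps)
        moreover have "card ({..<s} - J) = s - card J" using J by (simp add: card_Diff_subset)
        ultimately show ?thesis using True
          by (simp add: free_def card_PiE power_mono)
      next
        case False
        then show ?thesis using assms by (simp add: free_def)
      qed
    qed
    also have "\<dots> = real m ^ card J * ((1 - \<delta>) * real m) ^ (s - card J)"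
      using J by (simp add: card_PiE m_def)
    also have "\<dots> = real m ^ s * (1 - \<delta>) ^ (s - card J)"
      using J assms by (simp add: power_mult_distrib flip: power_add)
    also have "\<dots> \<le> real m ^ s * (1 - \<delta>) ^ (s - k)"
      using J assms by (intro mult_left_mono power_decreasing) auto
    finally show ?thesis .
  qed
  define Bad where "Bad = (\<Union>x\<in>D \<times> Is. bad (fst x) (snd x))"
  have "real (card Bad) \<le> real (\<Sum>x\<in>D \<times> Is. card (bad (fst x) (snd x)))"
    unfolding Bad_def of_nat_le_iff using assms finIs by (intro card_UN_le) auto
  also have "\<dots> \<le> (\<Sum>x\<in>D \<times> Is. real m ^ s * (1 - \<delta>) ^ (s - k))"
    unfolding of_nat_sum by (intro sum_mono bad_le) auto
  also have "\<dots> = real m ^ s * (real (card D) * real s ^ k * (1 - \<delta>) ^ (s - k))"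
    using cardIs by (simp add: card_cartesian_product)
  also have "\<dots> < real m ^ s * 1"
    using small m by (intro mult_strict_left_mono) auto
  finally have "card Bad < card \<Omega>" by (simp add: card\<Omega> flip: of_nat_power)
  moreover have "Bad \<subseteq> \<Omega>" by (auto simp: Bad_def bad_def)
  ultimately have "\<not> \<Omega> \<subseteq> Bad"
    using card_mono[OF finite_subset[OF \<open>Bad \<subseteq> \<Omega>\<close> fin\<Omega>]] by (auto simp: not_le)
  then obtain \<omega> where \<omega>: "\<omega> \<in> \<Omega>" "\<omega> \<notin> Bad" by auto
  show ?thesis
  proof
    show "\<omega> i \<in> B" if "i < s" for i using \<omega>(1) that by (auto simp: \<Omega>_def)
    show "real (card {b \<in> B. crosses d (map \<omega> ps) b}) \<le> \<delta> * real (card B)"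
      if "d \<in> D" "set ps \<subseteq> {..<s}" "length ps = k"
         "\<And>i. i < s \<Longrightarrow> \<not> crosses d (map \<omega> ps) (\<omega> i)" for d  ps
    proof -
      have "(d, ps) \<in> D \<times> Is" using that by (simp add: Is_def)
      then have "\<omega> \<notin> bad d ps" using \<omega>(2) by (force simp: Bad_def)
      then have "\<not> heavy d (map \<omega> ps)" using \<omega>(1) that(4) by (auto simp: bad_def)
      then show ?thesis by (simp add: heavy_def m_def)
    qed
  qed
qed

text \<open>The exponential decay in \<open>s\<close> beats \<open>s ^ k\<close> as soon as \<open>s\<close> is of order \<open>1 / \<delta> ^ (k + 1)\<close>, because
  \<open>exp z \<ge> (z / q) ^ q\<close> with \<open>q = k + 1\<close>. Sharper estimates would only improve the exponent.\<close>
lemma sample_size: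
  fixes c k :: nat
  obtains C :: real where "C \<ge> 1"
    "\<And>\<delta>::real. 0 < \<delta> \<Longrightarrow> \<delta> \<le> 1 \<Longrightarrow>
       \<exists>s::nat. k \<le> s \<and> 0 < s \<and> real s \<le> C / \<delta> ^ Suc k \<and> real c * real s ^ k * (1 - \<delta>) ^ (s - k) < 1"
proof
  define q where "q = Suc k"
  define C where "C = 2 * (real c * (2 * real q) ^ q) + 2 * real k + 2"
  have "0 \<le> real c * (2 * real q) ^ q" by simp
  then have C: "C \<ge> 2" "C \<ge> 2 * real k + 2" and C1: "real c * (2 * real q) ^ q < C"
    unfolding C_def by linarith+
  show "2 * C \<ge> 1" using C by simp
  fix \<delta> :: real assume \<delta>: "0 < \<delta>" "\<delta> \<le> 1"
  have \<delta>q: "0 < \<delta> ^ q" "\<delta> ^ q \<le> 1" using \<delta> by (simp_all add: power_le_one)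
  define s where "s = nat \<lceil>C / \<delta> ^ q\<rceil>"
  have Cd: "C / \<delta> ^ q \<ge> C" using C \<delta>q by (simp add: field_simps)
  have s_ge: "real s \<ge> C / \<delta> ^ q" unfolding s_def by linarith
  have s_le: "real s \<le> C / \<delta> ^ q + 1" unfolding s_def using C Cd by linarith
  have sk: "real s \<ge> 2 * real k" "real s > 0" using s_ge Cd C by linarith+
  have "C / \<delta> ^ q + 1 \<le> 2 * C / \<delta> ^ q" using Cd C by simp
  with s_le have "real s \<le> 2 * C / \<delta> ^ q" by linarith
  moreover have "real c * real s ^ k * (1 - \<delta>) ^ (s - k) < 1"
  proof -
    have ks: "k \<le> s" using sk by linarith
    define z where "z = \<delta> * real (s - k)"
    have half: "real (s - k) \<ge> real s / 2" using sk ks by (simp add: of_nat_diff)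
    have "z \<ge> 0" using \<delta> by (simp add: z_def)
    have "(1 - \<delta>) ^ (s - k) \<le> exp (- \<delta>) ^ (s - k)"
      using \<delta> exp_ge_add_one_self[of "-\<delta>"] by (intro power_mono) auto
    also have "\<dots> = exp (- z)" by (simp add: z_def exp_of_nat_mult[symmetric] mult.commute)
    finally have 1: "(1 - \<delta>) ^ (s - k) \<le> exp (- z)" .
    have "(\<delta> * real s / (2 * real q)) ^ q \<le> (1 + z / real q) ^ q"
    proof (rule power_mono)
      have "\<delta> * (real s / 2) \<le> z" unfolding z_def using half \<delta> by (intro mult_left_mono) auto
      then have "\<delta> * real s / (2 * real q) \<le> z / real q"
        using divide_right_mono[of "\<delta> * (real s / 2)" z "real q"] by simp
      then show "\<delta> * real s / (2 * real q) \<le> 1 + z / real q" by linarith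
    qed (use \<delta> in auto)
    also have "\<dots> \<le> exp z"
      using \<open>z \<ge> 0\<close> by (intro exp_ge_one_plus_x_over_n_power_n) (auto simp: q_def)
    finally have 2: "(\<delta> * real s / (2 * real q)) ^ q \<le> exp z" .
    have "real c * real s ^ k < (\<delta> * real s / (2 * real q)) ^ q"
    proof -
      have q: "real q > 0" by (simp add: q_def)
      have "C \<le> real s * \<delta> ^ q" using s_ge \<delta>q by (simp add: pos_divide_le_eq)
      then have "real c * (2 * real q) ^ q < real s * \<delta> ^ q"
        using C1 by linarith
      then have "real s ^ k * (real c * (2 * real q) ^ q) < real s ^ k * (real s * \<delta> ^ q)"
        using sk by (intro mult_strict_left_mono) auto
      also have "\<dots> = (\<delta> * real s) ^ q"
        unfolding power_mult_distrib by (simp add: q_def)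
      finally have "real c * real s ^ k * (2 * real q) ^ q < (\<delta> * real s) ^ q"
        by (simp only: mult_ac)
      then show ?thesis
        using q by (simp add: power_divide pos_less_divide_eq)
    qed
    with 2 have "real c * real s ^ k < exp z" by linarith
    then have "real c * real s ^ k * exp (- z) < 1" by (simp add: exp_minus field_simps)
    moreover have "real c * real s ^ k * (1 - \<delta>) ^ (s - k) \<le> real c * real s ^ k * exp (- z)"
      using 1 by (intro mult_left_mono) auto
    ultimately show ?thesis by linarith
  qed
  ultimately show "\<exists>s::nat. k \<le> s \<and> 0 < s \<and> real s \<le> 2 * C / \<delta> ^ Suc k \<and> real c * real s ^ k * (1 - \<delta>) ^ (s - k) < 1"
    using sk by (intro exI[of _ s]) (auto simp: q_def)
qed

section \<open>Cuttings for graphs that meet at most once\<close>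

lemma sgn_eq_sgn_iff: "sgn a = sgn b \<longleftrightarrow> (a < 0 \<longleftrightarrow> b < 0) \<and> (0 < a \<longleftrightarrow> 0 < b)" for a b :: real
  by (auto simp: sgn_if)

text \<open>The indices \<open>i\<close> and \<open>j\<close> are those of the neighbours of \<open>y\<close> among the values of \<open>w\<close>; if \<open>y\<close> has
  a neighbour on one side only, the other index is arbitrary. A second
  function \<open>w'\<close> appears because the heights of graphs change from one vertical line to another
  while their order is preserved; knowing how all heights compare with the two neighbours is enough
  to place \<open>y'\<close>.\<close>
lemma bracketing_pair:
  fixes w :: "'i \<Rightarrow> real" and y :: real
  assumes S: "finite S" "S \<noteq> {}"
  obtains i j where "i \<in> S" "j \<in> S"
    "\<And>w' y' h. \<lbrakk>\<And>k. k \<in> S \<Longrightarrow> sgn (w' k - w' i) = sgn (w k - w i);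
        \<And>k. k \<in> S \<Longrightarrow> sgn (w' k - w' j) = sgn (w k - w j);
        sgn (y' - w' i) = sgn (y - w i); sgn (y' - w' j) = sgn (y - w j); h \<in> S\<rbrakk>
      \<Longrightarrow> sgn (y' - w' h) = sgn (y - w h :: real)"
proof -
  have low: "\<exists>i\<in>S. \<forall>k\<in>S. w k \<le> y \<longrightarrow> w k \<le> w i \<and> w i \<le> y"
  proof (cases "{k \<in> S. w k \<le> y} = {}")
    case False
    let ?m = "Max (w ` {k \<in> S. w k \<le> y})"
    have fin: "finite (w ` {k \<in> S. w k \<le> y})" using S by simp
    have "?m \<in> w ` {k \<in> S. w k \<le> y}" using fin False by (intro Max_in) auto
    then obtain i where "i \<in> S" "w i \<le> y" "w i = ?m" by auto
    then show ?thesis using fin by (intro bexI[of _ i]) auto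
  qed (use S in auto)
  have high: "\<exists>i\<in>S. \<forall>k\<in>S. y \<le> w k \<longrightarrow> w i \<le> w k \<and> y \<le> w i"
  proof (cases "{k \<in> S. y \<le> w k} = {}")
    case False
    let ?m = "Min (w ` {k \<in> S. y \<le> w k})"
    have fin: "finite (w ` {k \<in> S. y \<le> w k})" using S by simp
    have "?m \<in> w ` {k \<in> S. y \<le> w k}" using fin False by (intro Min_in) auto
    then obtain i where "i \<in> S" "y \<le> w i" "w i = ?m" by auto
    then show ?thesis using fin by (intro bexI[of _ i]) auto
  qed (use S in auto)
  obtain i j where ij: "i \<in> S" "j \<in> S" "\<And>k. k \<in> S \<Longrightarrow> w k \<le> y \<Longrightarrow> w k \<le> w i \<and> w i \<le> y"
     "\<And>k. k \<in> S \<Longrightarrow> y \<le> w k \<Longrightarrow> w j \<le> w k \<and> y \<le> w j"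
    using low high by blast
  show ?thesis
  proof
    fix w' y' h
    assume *: "\<And>k. k \<in> S \<Longrightarrow> sgn (w' k - w' i) = sgn (w k - w i)"
        "\<And>k. k \<in> S \<Longrightarrow> sgn (w' k - w' j) = sgn (w k - w j)"
        "sgn (y' - w' i) = sgn (y - w i)" "sgn (y' - w' j) = sgn (y - w j :: real)" "h \<in> S"
    show "sgn (y' - w' h) = sgn (y - w h)"
      using *(1,2)[OF \<open>h \<in> S\<close>] *(3,4) ij(3,4)[OF \<open>h \<in> S\<close>]
      unfolding sgn_eq_sgn_iff by (smt (verit))
  qed (use ij in auto)
qed

lemma zero_strictly_between:
  fixes f :: "real \<Rightarrow> real"
  assumes "continuous_on {a..b} f" "a \<le> b" "f a * f b < 0"
  obtains z where "a < z" "z < b" "f z = 0"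
proof -
  have "\<exists>z\<ge>a. z \<le> b \<and> f z = 0"
  proof (cases "f a < 0")
    case True
    then have "f b > 0" using assms by (simp add: mult_less_0_iff)
    then show ?thesis using IVT'[of f a 0 b] True assms by auto
  next
    case False
    then have "f a > 0" "f b < 0" using assms by (auto simp: mult_less_0_iff)
    then show ?thesis using IVT2'[of f b 0 a] assms by auto
  qed
  then obtain z where z: "a \<le> z" "z \<le> b" "f z = 0" by blast
  moreover have "z \<noteq> a" "z \<noteq> b" using z assms by auto
  ultimately show ?thesis using that[of z] by auto
qed

definition once_meeting_graphs ::
  "'b set \<Rightarrow> ('b \<Rightarrow> real) \<Rightarrow> ('b \<Rightarrow> real) \<Rightarrow> ('b \<Rightarrow> real \<Rightarrow> real) \<Rightarrow> bool" where
  "once_meeting_graphs B l r g \<longleftrightarrow>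
     (\<forall>b\<in>B. l b \<le> r b \<and> continuous_on {l b..r b} (g b)) \<and>
     (\<forall>b\<in>B. \<forall>b'\<in>B. b \<noteq> b' \<longrightarrow>
       (\<forall>x\<in>{l b..r b} \<inter> {l b'..r b'}. \<forall>y\<in>{l b..r b} \<inter> {l b'..r b'}.
          g b x = g b' x \<longrightarrow> g b y = g b' y \<longrightarrow> x = y))"

lemma once_meeting_graphs_continuous:
  assumes "once_meeting_graphs B l r g" "b \<in> B"
  shows "continuous_on {l b..r b} (g b)"
  using assms unfolding once_meeting_graphs_def by simp

lemma once_meeting_graphs_unique:
  assumes "once_meeting_graphs B l r g" "b \<in> B" "b' \<in> B" "b \<noteq> b'"
    "x \<in> {l b..r b} \<inter> {l b'..r b'}" "y \<in> {l b..r b} \<inter> {l b'..r b'}"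
    "g b x = g b' x" "g b y = g b' y"
  shows "x = y"
  using assms(1)[unfolded once_meeting_graphs_def, THEN conjunct2, rule_format, OF assms(2-8)] .

lemma once_meeting_graphs_subset:
  assumes B: "once_meeting_graphs B l r g" and S: "S \<subseteq> B"
  shows "once_meeting_graphs S l r g"
  unfolding once_meeting_graphs_def
proof (intro conjI ballI impI)
  show "l b \<le> r b" "continuous_on {l b..r b} (g b)" if "b \<in> S" for b
    using B that S unfolding once_meeting_graphs_def by auto
qed (rule once_meeting_graphs_unique[OF B subsetD[OF S] subsetD[OF S]])

text \<open>The third component is meaningful only above the domain, which is recognizable from the first two.\<close>
definition position :: "real \<Rightarrow> real \<Rightarrow> (real \<Rightarrow> real) \<Rightarrow> real \<times> real \<Rightarrow> real \<times> real \<times> real" where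
  "position l r g p = (sgn (fst p - l), sgn (fst p - r),
     if l \<le> fst p \<and> fst p \<le> r then sgn (snd p - g (fst p)) else 0)"

text \<open>The abscissas of the vertical walls: the ends of a domain (kinds 0 and 1) and the crossing of two
  graphs (kind 2). The last one is arbitrary if the graphs do not meet or are the same; an extra wall merely refines the decomposition.\<close>
definition wall :: "('b \<Rightarrow> real) \<Rightarrow> ('b \<Rightarrow> real) \<Rightarrow> ('b \<Rightarrow> real \<Rightarrow> real) \<Rightarrow> nat \<times> 'b \<times> 'b \<Rightarrow> real" where
  "wall l r g v = (case v of (k, b, b') \<Rightarrow>
     if k = 0 then l b else if k = 1 then r b
     else (SOME x. x \<in> {l b..r b} \<inter> {l b'..r b'} \<and> g b x = g b' x))"

type_synonym cell_flags = "nat \<times> nat \<times> real \<times> real \<times> real \<times> real \<times> bool"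

definition all_cell_flags :: "cell_flags set" where
  "all_cell_flags = {..<3} \<times> {..<3} \<times> {-1,0,1} \<times> {-1,0,1} \<times> {-1,0,1} \<times> {-1,0,1} \<times> UNIV"

text \<open>The list \<open>bs\<close> holds two graphs for each of the two walls and then the two graphs that bound the cell
  vertically; if no graph of the sample lies over the slab, \<open>spanned\<close> is false. Signs serve as
  flags so that unbounded cells, and cells contained in a wall or in a graph, need no separate
  treatment: a cell may lie on the same side of both walls or of both graphs, or on one of them.\<close>
definition cell :: "('b \<Rightarrow> real) \<Rightarrow> ('b \<Rightarrow> real) \<Rightarrow> ('b \<Rightarrow> real \<Rightarrow> real) \<Rightarrow> cell_flags \<Rightarrow> 'b list
    \<Rightarrow> (real \<times> real) set" where
  "cell l r g d bs = (case d of (k1, k2, e1, e2, e3, e4, spanned) \<Rightarrow>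
     {p. sgn (fst p - wall l r g (k1, bs ! 0, bs ! 1)) = e1 \<and>
         sgn (fst p - wall l r g (k2, bs ! 2, bs ! 3)) = e2 \<and>
         (spanned \<longrightarrow> sgn (snd p - g (bs ! 4) (fst p)) = e3 \<and>
                    sgn (snd p - g (bs ! 5) (fst p)) = e4)})"

lemma finite_cell_flags: "finite all_cell_flags"
  by (simp add: all_cell_flags_def)

lemma ex_lists_over_image:
  assumes "set bs \<subseteq> f ` A"
  shows "\<exists>ps. set ps \<subseteq> A \<and> bs = map f ps"
proof -
  have "bs \<in> lists (f ` A)" using assms by auto
  then obtain ps where "ps \<in> lists A" "bs = map f ps" unfolding lists_image by blast
  then show ?thesis by (intro exI[of _ ps]) auto
qed

text \<open>A change of order between \<open>x\<close> and \<open>y\<close> forces the two graphs to meet strictly between \<open>x\<close> and \<open>y\<close>, or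
  at exactly one of them, and the wall through their only meeting point would separate \<open>x\<close> from \<open>y\<close>.\<close>
lemma order_constant_off_walls:
  fixes l r :: "'b \<Rightarrow> real" and g :: "'b \<Rightarrow> real \<Rightarrow> real"
  assumes cont: "continuous_on {l b..r b} (g b)" "continuous_on {l b'..r b'} (g b')"
    and once: "\<And>x y. b \<noteq> b' \<Longrightarrow> x \<in> {l b..r b} \<inter> {l b'..r b'} \<Longrightarrow> y \<in> {l b..r b} \<inter> {l b'..r b'} \<Longrightarrow>
                 g b x = g b' x \<Longrightarrow> g b y = g b' y \<Longrightarrow> x = y"
    and x: "x \<in> {l b..r b} \<inter> {l b'..r b'}" and y: "y \<in> {l b..r b} \<inter> {l b'..r b'}"
    and wall: "sgn (x - wall l r g (2, b, b')) = sgn (y - wall l r g (2, b, b'))"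
  shows "sgn (g b x - g b' x) = sgn (g b y - g b' y)"
proof (cases "b = b'")
  case False
  let ?I = "{l b..r b} \<inter> {l b'..r b'}"
  have meet: "wall l r g (2, b, b') = z" if "z \<in> ?I" "g b z = g b' z" for z
    unfolding wall_def using once[OF False] that
    by (auto intro!: some_equality)
  define f where "f z = g b z - g b' z" for z
  have main: "sgn (f u) = sgn (f v)"
    if uv: "u \<in> ?I" "v \<in> ?I" "u \<le> v"
      "sgn (u - wall l r g (2, b, b')) = sgn (v - wall l r g (2, b, b'))" for u v
  proof (rule ccontr)
    assume ne: "sgn (f u) \<noteq> sgn (f v)"
    have "f u \<noteq> 0"
      using meet[of u] that ne unfolding f_def by (auto simp: sgn_eq_0_iff sgn_0_0)
    moreover have "f v \<noteq> 0"
      using meet[of v] that ne unfolding f_def by (auto simp: sgn_eq_0_iff sgn_0_0)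
    ultimately have "f u * f v < 0" using ne by (auto simp: sgn_if mult_less_0_iff split: if_splits)
    moreover have "continuous_on {u..v} f"
      unfolding f_def using that
      by (intro continuous_intros continuous_on_subset[OF cont(1)] continuous_on_subset[OF cont(2)]) auto
    ultimately obtain z where z: "u < z" "z < v" "f z = 0"
      using zero_strictly_between uv(3) by metis
    then have "wall l r g (2, b, b') = z" using uv by (intro meet) (auto simp: f_def)
    then show False using z uv(4) by simp
  qed
  show ?thesis
    using main[OF x y _ wall] main[OF y x _ wall[symmetric]] linear[of x y]
    unfolding f_def by metis
qed simp

text \<open>The cell of \<open>p\<close> is found by taking first the neighbours of its abscissa among all walls, then the
  neighbours of its height among the graphs over that slab. Within the slab the same graphs are
  present in the same vertical order, so comparison with the two neighbours fixes the position with
  respect to every member of \<open>S\<close>.\<close>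
lemma points_lie_in_uncrossed_cells:
  fixes l r :: "'b \<Rightarrow> real" and g :: "'b \<Rightarrow> real \<Rightarrow> real"
  assumes S: "finite S" "S \<noteq> {}" and graphs: "once_meeting_graphs S l r g"
  shows "\<exists>d\<in>all_cell_flags. \<exists>bs. set bs \<subseteq> S \<and> length bs = 6 \<and> p \<in> cell l r g d bs \<and>
      (\<forall>h\<in>S. \<forall>p'\<in>cell l r g d bs. position (l h) (r h) (g h) p' = position (l h) (r h) (g h) p)"
proof -
  define x where "x = fst p"
  define W where "W = {..<3::nat} \<times> S \<times> S"
  let ?w = "wall l r g"
  have W: "finite W" "W \<noteq> {}" using S by (auto simp: W_def lessThan_empty_iff)
  obtain v1 v2 where v: "v1 \<in> W" "v2 \<in> W" and
    vall: "\<And>x' v. sgn (x' - ?w v1) = sgn (x - ?w v1) \<Longrightarrow> sgn (x' - ?w v2) = sgn (x - ?w v2) \<Longrightarrow> v \<in> W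
        \<Longrightarrow> sgn (x' - ?w v) = sgn (x - ?w v)"
    by (rule bracketing_pair[OF W, of ?w x]) blast
  obtain k1 b0 b1 k2 b2 b3 where v12: "v1 = (k1, b0, b1)" "v2 = (k2, b2, b3)"
    by (metis prod.exhaust)
  have sgn_in: "sgn z \<in> {-1, 0, 1}" for z :: real by (auto simp: sgn_if)
  define Act where "Act = {h \<in> S. l h \<le> x \<and> x \<le> r h}"
  have sgns: "sgn (x' - l h) = sgn (x - l h)" "sgn (x' - r h) = sgn (x - r h)"
    "h' \<in> S \<Longrightarrow> sgn (x' - ?w (2, h, h')) = sgn (x - ?w (2, h, h'))"
    if "sgn (x' - ?w v1) = sgn (x - ?w v1)" "sgn (x' - ?w v2) = sgn (x - ?w v2)" "h \<in> S" for x' h h'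
    using vall[OF that(1,2), of "(0, h, h)"] vall[OF that(1,2), of "(1, h, h)"]
      vall[OF that(1,2), of "(2, h, h')"] that(3) by (auto simp: W_def wall_def)
  have active: "l h \<le> x' \<and> x' \<le> r h \<longleftrightarrow> h \<in> Act"
    if "sgn (x' - ?w v1) = sgn (x - ?w v1)" "sgn (x' - ?w v2) = sgn (x - ?w v2)" "h \<in> S" for x' h
    using sgns(1,2)[OF that] that(3) unfolding sgn_eq_sgn_iff Act_def by auto
  show ?thesis
  proof (cases "Act = {}")
    case True
    let ?d = "(k1, k2, sgn (x - ?w v1), sgn (x - ?w v2), 0, 0, False)"
    let ?bs = "[b0, b1, b2, b3, b0, b0]"
    have "?d \<in> all_cell_flags" "set ?bs \<subseteq> S" "length ?bs = 6"
      using v v12 sgn_in by (auto simp: all_cell_flags_def W_def)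
    moreover have cell: "cell l r g ?d ?bs =
        {p'. sgn (fst p' - ?w v1) = sgn (x - ?w v1) \<and> sgn (fst p' - ?w v2) = sgn (x - ?w v2)}"
      by (simp add: cell_def v12 eval_nat_numeral)
    moreover have "p \<in> cell l r g ?d ?bs" unfolding cell by (simp add: x_def)
    moreover have "position (l h) (r h) (g h) p' = position (l h) (r h) (g h) p"
      if "h \<in> S" "p' \<in> cell l r g ?d ?bs" for h p'
    proof -
      have p': "sgn (fst p' - ?w v1) = sgn (x - ?w v1)" "sgn (fst p' - ?w v2) = sgn (x - ?w v2)"
        using that(2) unfolding cell by auto
      show ?thesis using sgns(1,2)[OF p' that(1)] active[OF p' that(1)] active[OF refl refl that(1)] True
        by (auto simp: position_def x_def)
    qed
    ultimately show ?thesis by blast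
  next
    case False
    have fin: "finite Act" using S by (simp add: Act_def)
    obtain h1 h2 where h: "h1 \<in> Act" "h2 \<in> Act" and
      hall: "\<And>w' y' h. \<lbrakk>\<And>k. k \<in> Act \<Longrightarrow> sgn (w' k - w' h1) = sgn (g k x - g h1 x);
          \<And>k. k \<in> Act \<Longrightarrow> sgn (w' k - w' h2) = sgn (g k x - g h2 x);
          sgn (y' - w' h1) = sgn (snd p - g h1 x); sgn (y' - w' h2) = sgn (snd p - g h2 x); h \<in> Act\<rbrakk>
        \<Longrightarrow> sgn (y' - w' h) = sgn (snd p - g h x)"
      by (rule bracketing_pair[OF fin False, of "\<lambda>h. g h x" "snd p"]) blast
    let ?d = "(k1, k2, sgn (x - ?w v1), sgn (x - ?w v2), sgn (snd p - g h1 x), sgn (snd p - g h2 x), True)"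
    let ?bs = "[b0, b1, b2, b3, h1, h2]"
    have "?d \<in> all_cell_flags" "set ?bs \<subseteq> S" "length ?bs = 6"
      using v v12 sgn_in h by (auto simp: all_cell_flags_def W_def Act_def)
    moreover have cell: "cell l r g ?d ?bs =
        {p'. sgn (fst p' - ?w v1) = sgn (x - ?w v1) \<and> sgn (fst p' - ?w v2) = sgn (x - ?w v2) \<and>
             sgn (snd p' - g h1 (fst p')) = sgn (snd p - g h1 x) \<and>
             sgn (snd p' - g h2 (fst p')) = sgn (snd p - g h2 x)}"
      by (simp add: cell_def v12 eval_nat_numeral)
    moreover have "p \<in> cell l r g ?d ?bs" unfolding cell by (simp add: x_def)
    moreover have "position (l h) (r h) (g h) p' = position (l h) (r h) (g h) p"
      if "h \<in> S" "p' \<in> cell l r g ?d ?bs" for h p'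
    proof -
      have p': "sgn (fst p' - ?w v1) = sgn (x - ?w v1)" "sgn (fst p' - ?w v2) = sgn (x - ?w v2)"
        using that(2) unfolding cell by auto
      have order: "sgn (g k (fst p') - g k' (fst p')) = sgn (g k x - g k' x)"
        if "k \<in> Act" "k' \<in> Act" for k k'
      proof -
        have kS: "k \<in> S" "k' \<in> S" using that by (auto simp: Act_def)
        show ?thesis
        proof (rule order_constant_off_walls)
          show "fst p' \<in> {l k..r k} \<inter> {l k'..r k'}" "x \<in> {l k..r k} \<inter> {l k'..r k'}"
            using active[OF p' kS(1)] active[OF p' kS(2)] that by (auto simp: Act_def)
          show "sgn (fst p' - ?w (2, k, k')) = sgn (x - ?w (2, k, k'))"
            using sgns(3)[OF p' kS] .
        qed (fact once_meeting_graphs_continuous[OF graphs kS(1)]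
             once_meeting_graphs_continuous[OF graphs kS(2)]
             once_meeting_graphs_unique[OF graphs kS])+
      qed
      have "sgn (snd p' - g h (fst p')) = sgn (snd p - g h x)" if "h \<in> Act"
        using hall[of "\<lambda>k. g k (fst p')" "snd p'" h] order h that \<open>p' \<in> cell l r g ?d ?bs\<close>
        unfolding cell by auto
      then show ?thesis
        using sgns(1,2)[OF p' that(1)] active[OF p' that(1)] active[OF refl refl that(1)]
        by (auto simp: position_def x_def)
    qed
    ultimately show ?thesis by blast
  qed
qed

text \<open>Only the partition of the plane into the level sets of \<open>desc\<close> matters; these may be smaller than the
  geometric cells from which they come.\<close>
definition cutting_for :: "'b set \<Rightarrow> ('b \<Rightarrow> real) \<Rightarrow> ('b \<Rightarrow> real) \<Rightarrow> ('b \<Rightarrow> real \<Rightarrow> real) \<Rightarrow> real \<Rightarrow>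
    (real \<times> real \<Rightarrow> 'd) \<Rightarrow> bool" where
  "cutting_for B l r g \<delta> desc \<longleftrightarrow> finite (range desc) \<and>
     (\<forall>p. real (card {b \<in> B. \<exists>p'. desc p' = desc p \<and>
        position (l b) (r b) (g b) p' \<noteq> position (l b) (r b) (g b) p}) \<le> \<delta> * real (card B))"

text \<open>A sample of order \<open>1 / \<delta> ^ 7\<close> is representative for cells described by six graphs, and it describes
  of the order of \<open>(1 / \<delta> ^ 7) ^ 6\<close> cells.\<close>
lemma cutting_exists:
  obtains C :: real where "C \<ge> 1"
    "\<And>(B :: 'b set) l r g \<delta>.
       \<lbrakk>finite B; B \<noteq> {}; 0 < \<delta>; \<delta> \<le> 1; once_meeting_graphs B l r g\<rbrakk>
       \<Longrightarrow> \<exists>desc :: real \<times> real \<Rightarrow> cell_flags \<times> nat list.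
             cutting_for B l r g \<delta> desc \<and> real (card (range desc)) \<le> C / \<delta> ^ 42"
proof -
  define c where "c = card all_cell_flags"
  have c: "c \<ge> 1" using finite_cell_flags
    by (auto simp: c_def Suc_le_eq card_gt_0_iff all_cell_flags_def lessThan_empty_iff)
  obtain C where C: "C \<ge> 1" and
    size: "\<And>\<delta>::real. 0 < \<delta> \<Longrightarrow> \<delta> \<le> 1 \<Longrightarrow>
       \<exists>s::nat. 6 \<le> s \<and> 0 < s \<and> real s \<le> C / \<delta> ^ Suc 6 \<and> real c * real s ^ 6 * (1 - \<delta>) ^ (s - 6) < 1"
    using sample_size by blast
  show ?thesis
  proof
    show "real c * C ^ 6 \<ge> 1" using c C by (intro mult_ge1_I one_le_power) auto
    fix B :: "'b set" and l r :: "'b \<Rightarrow> real" and g :: "'b \<Rightarrow> real \<Rightarrow> real" and \<delta> :: real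
    assume B: "finite B" "B \<noteq> {}" and \<delta>: "0 < \<delta>" "\<delta> \<le> 1"
      and graphs: "once_meeting_graphs B l r g"
    obtain s where s: "6 \<le> s" "0 < s" "real s \<le> C / \<delta> ^ Suc 6"
        "real c * real s ^ 6 * (1 - \<delta>) ^ (s - 6) < 1"
      using size[OF \<delta>] by blast
    define crosses where "crosses d bs b \<longleftrightarrow> (\<exists>p\<in>cell l r g d bs. \<exists>p'\<in>cell l r g d bs.
       position (l b) (r b) (g b) p' \<noteq> position (l b) (r b) (g b) p)" for d bs b
    obtain \<omega> where \<omega>: "\<And>i. i < s \<Longrightarrow> \<omega> i \<in> B"
      and net: "\<And>d ps. d \<in> all_cell_flags \<Longrightarrow> set ps \<subseteq> {..<s} \<Longrightarrow> length ps = 6 \<Longrightarrow>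
           (\<And>i. i < s \<Longrightarrow> \<not> crosses d (map \<omega> ps) (\<omega> i)) \<Longrightarrow>
           real (card {b \<in> B. crosses d (map \<omega> ps) b}) \<le> \<delta> * real (card B)"
      using representative_sample[OF B finite_cell_flags \<delta> s(1), of crosses] s(4)
      unfolding c_def by blast
    define Ps where "Ps = {ps. set ps \<subseteq> {..<s} \<and> length ps = 6}"
    have Ps: "finite Ps" "card Ps = s ^ 6"
      using finite_lists_length_eq[of "{..<s}" 6] card_lists_length_eq[of "{..<s}" 6]
      by (simp_all add: Ps_def)
    have "\<exists>q\<in>all_cell_flags \<times> Ps. p \<in> cell l r g (fst q) (map \<omega> (snd q)) \<and>
      (\<forall>i<s. \<not> crosses (fst q) (map \<omega> (snd q)) (\<omega> i))" for p
    proof -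
      let ?S = "\<omega> ` {..<s}"
      have "\<exists>d\<in>all_cell_flags. \<exists>bs. set bs \<subseteq> ?S \<and> length bs = 6 \<and> p \<in> cell l r g d bs \<and>
        (\<forall>h\<in>?S. \<forall>p'\<in>cell l r g d bs. position (l h) (r h) (g h) p' = position (l h) (r h) (g h) p)"
      proof (rule points_lie_in_uncrossed_cells)
        show "finite ?S" by simp
        show "?S \<noteq> {}" using s(2) by auto
        show "once_meeting_graphs ?S l r g"
          using \<omega> by (intro once_meeting_graphs_subset[OF graphs]) auto
      qed
      then obtain d bs where d: "d \<in> all_cell_flags" "set bs \<subseteq> ?S" "length bs = 6" "p \<in> cell l r g d bs"
        "\<And>h p'. h \<in> ?S \<Longrightarrow> p' \<in> cell l r g d bs \<Longrightarrow>
           position (l h) (r h) (g h) p' = position (l h) (r h) (g h) p" by blast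
      obtain ps where ps: "set ps \<subseteq> {..<s}" "bs = map \<omega> ps"
        using ex_lists_over_image[OF d(2)] by blast
      have "(d, ps) \<in> all_cell_flags \<times> Ps" using d ps by (auto simp: Ps_def)
      moreover have "\<not> crosses d (map \<omega> ps) (\<omega> i)" if "i < s" for i
        using d(5)[of "\<omega> i"] that ps(2) unfolding crosses_def by (metis imageI lessThan_iff)
      ultimately show ?thesis using d(4) ps(2) by force
    qed
    then obtain desc where desc: "\<And>p. desc p \<in> all_cell_flags \<times> Ps"
      "\<And>p. p \<in> cell l r g (fst (desc p)) (map \<omega> (snd (desc p)))"
      "\<And>p i. i < s \<Longrightarrow> \<not> crosses (fst (desc p)) (map \<omega> (snd (desc p))) (\<omega> i)" by metis
    have fin: "finite (all_cell_flags \<times> Ps)" using Ps finite_cell_flags by simp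
    have sub: "range desc \<subseteq> all_cell_flags \<times> Ps" using desc(1) by blast
    have "cutting_for B l r g \<delta> desc"
      unfolding cutting_for_def
    proof (intro conjI allI)
      show "finite (range desc)" using fin sub finite_subset by blast
      fix p
      let ?cr = "{b \<in> B. crosses (fst (desc p)) (map \<omega> (snd (desc p))) b}"
      have "{b \<in> B. \<exists>p'. desc p' = desc p \<and> position (l b) (r b) (g b) p' \<noteq> position (l b) (r b) (g b) p}
         \<subseteq> ?cr" unfolding crosses_def using desc(2) by (auto, metis)
      then have "card {b \<in> B. \<exists>p'. desc p' = desc p \<and>
          position (l b) (r b) (g b) p' \<noteq> position (l b) (r b) (g b) p} \<le> card ?cr"
        using B by (intro card_mono) auto
      moreover have "real (card ?cr) \<le> \<delta> * real (card B)"
        using desc(1)[of p] desc(3) by (intro net) (auto simp: Ps_def)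
      ultimately show "real (card {b \<in> B. \<exists>p'. desc p' = desc p \<and>
          position (l b) (r b) (g b) p' \<noteq> position (l b) (r b) (g b) p}) \<le> \<delta> * real (card B)" by linarith
    qed
    moreover have "real (card (range desc)) \<le> real c * C ^ 6 / \<delta> ^ 42"
    proof -
      have "card (range desc) \<le> c * s ^ 6"
        using card_mono[OF fin sub] Ps by (simp add: c_def card_cartesian_product)
      then have "real (card (range desc)) \<le> real c * real s ^ 6"
        by (metis of_nat_le_iff of_nat_mult of_nat_power)
      also have "\<dots> \<le> real c * (C / \<delta> ^ 7) ^ 6"
        using s(3) by (intro mult_left_mono power_mono) auto
      also have "\<dots> = real c * C ^ 6 / \<delta> ^ 42"
        by (simp add: power_divide flip: power_mult)
      finally show ?thesis .
    qed
    ultimately show "\<exists>desc :: real \<times> real \<Rightarrow> cell_flags \<times> nat list.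
        cutting_for B l r g \<delta> desc \<and> real (card (range desc)) \<le> real c * C ^ 6 / \<delta> ^ 42"
      by blast
  qed
qed

section \<open>Rectangles with constant types\<close>

text \<open>Here \<open>\<sigma>\<close> is controlled along the classes of \<open>\<kappa>\<close> in the first argument, and \<open>\<tau>\<close> along the classes of
  \<open>\<nu>\<close> in the second. Remove from \<open>E\<close> the few pairs where a type fails to be constant along the
  class, and keep the most popular combination of classes and types. Let \<open>A'\<close> and \<open>B'\<close> be the two
  projections of what is left. For \<open>a \<in> A'\<close> and \<open>b \<in> B'\<close> there are pairs \<open>(a1, b)\<close> and \<open>(a, b1)\<close>
  left; the first gives the right value to \<open>\<sigma> a b\<close>, since \<open>a\<close> and \<open>a1\<close> share a class, and the second
  to \<open>\<tau> a b\<close>.\<close>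
lemma homogeneous_rectangle:
  fixes A :: "'a set" and B :: "'b set" and \<kappa> :: "'a \<Rightarrow> 'x" and \<nu> :: "'b \<Rightarrow> 'y"
    and \<sigma> \<tau> :: "'a \<Rightarrow> 'b \<Rightarrow> 's" and \<eta> \<delta> K :: real
  assumes fin: "finite A" "finite B" and ne: "A \<noteq> {}" "B \<noteq> {}" and E: "E \<subseteq> A \<times> B"
    and dense: "\<eta> * real (card A) * real (card B) \<le> real (card E)" and \<eta>: "2 * \<delta> < \<eta>"
    and classes: "real (card (\<kappa> ` A)) \<le> K" "real (card (\<nu> ` B)) \<le> K"
    and types: "finite T" "\<And>a b. \<sigma> a b \<in> T" "\<And>a b. \<tau> a b \<in> T"
    and bad1: "\<And>a. a \<in> A \<Longrightarrow>
      real (card {b \<in> B. \<exists>a'\<in>A. \<kappa> a' = \<kappa> a \<and> \<sigma> a' b \<noteq> \<sigma> a b}) \<le> \<delta> * real (card B)"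
    and bad2: "\<And>b. b \<in> B \<Longrightarrow>
      real (card {a \<in> A. \<exists>b'\<in>B. \<nu> b' = \<nu> b \<and> \<tau> a b' \<noteq> \<tau> a b}) \<le> \<delta> * real (card A)"
  obtains a0 b0 A' B' where "(a0, b0) \<in> E" "A' \<subseteq> A" "B' \<subseteq> B"
    "\<And>a b. a \<in> A' \<Longrightarrow> b \<in> B' \<Longrightarrow> \<sigma> a b = \<sigma> a0 b0 \<and> \<tau> a b = \<tau> a0 b0"
    "(\<eta> - 2 * \<delta>) * real (card A) * real (card B)
       \<le> K\<^sup>2 * (real (card T))\<^sup>2 * (real (card A') * real (card B'))"
proof -
  define N1 where "N1 = Sigma A (\<lambda>a. {b \<in> B. \<exists>a'\<in>A. \<kappa> a' = \<kappa> a \<and> \<sigma> a' b \<noteq> \<sigma> a b})"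
  define N2 where "N2 = Sigma B (\<lambda>b. {a \<in> A. \<exists>b'\<in>B. \<nu> b' = \<nu> b \<and> \<tau> a b' \<noteq> \<tau> a b})"
  define N2' where "N2' = prod.swap ` N2"
  define E' where "E' = E - (N1 \<union> N2')"
  have N1: "real (card N1) \<le> \<delta> * real (card A) * real (card B)"
  proof -
    have "real (card N1) = (\<Sum>a\<in>A. real (card {b \<in> B. \<exists>a'\<in>A. \<kappa> a' = \<kappa> a \<and> \<sigma> a' b \<noteq> \<sigma> a b}))"
      using fin unfolding N1_def by (subst card_SigmaI) auto
    also have "\<dots> \<le> (\<Sum>a\<in>A. \<delta> * real (card B))" by (intro sum_mono bad1)
    finally show ?thesis by (simp add: mult_ac)
  qed
  have N2: "real (card N2') \<le> \<delta> * real (card A) * real (card B)"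
  proof -
    have "card N2' = card N2" unfolding N2'_def by (rule card_image) simp
    also have "real (card N2) = (\<Sum>b\<in>B. real (card {a \<in> A. \<exists>b'\<in>B. \<nu> b' = \<nu> b \<and> \<tau> a b' \<noteq> \<tau> a b}))"
      using fin unfolding N2_def by (subst card_SigmaI) auto
    also have "\<dots> \<le> (\<Sum>b\<in>B. \<delta> * real (card A))" by (intro sum_mono bad2)
    finally show ?thesis by (simp add: mult_ac)
  qed
  have finE: "finite E" "finite E'"
    using finite_subset[OF E] fin by (auto simp: E'_def)
  have finN: "finite N1" "finite N2'" using fin by (auto simp: N1_def N2'_def N2_def)
  have "card E \<le> card (E' \<union> (N1 \<union> N2'))" 
    using finE finN by (intro card_mono) (auto simp: E'_def)
  also have "\<dots> \<le> card E' + (card N1 + card N2')"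
    by (meson card_Un_le add_left_mono order_trans)
  finally have "real (card E) \<le> real (card E') + (real (card N1) + real (card N2'))"
    by (metis of_nat_le_iff of_nat_add)
  then have E'_ge: "(\<eta> - 2 * \<delta>) * real (card A) * real (card B) \<le> real (card E')"
    using dense N1 N2 by (simp add: algebra_simps)
  have "0 < (\<eta> - 2 * \<delta>) * real (card A) * real (card B)"
    using \<eta> ne fin by (simp add: card_gt_0_iff)
  then have "E' \<noteq> {}" using E'_ge by auto
  define \<psi> where "\<psi> = (\<lambda>(a, b). (\<kappa> a, \<nu> b, \<sigma> a b, \<tau> a b))"
  let ?R = "\<kappa> ` A \<times> \<nu> ` B \<times> T \<times> T"
  have finR: "finite ?R" using fin types by simp
  have "\<psi> ` E' \<subseteq> ?R" using E types by (auto simp: \<psi>_def E'_def)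
  moreover have R: "?R \<noteq> {}" using ne types by auto
  ultimately obtain v where v: "v \<in> ?R" "card E' \<le> card (\<psi> -` {v} \<inter> E') * card ?R"
    using pigeonhole_card[of \<psi> E' ?R] finE finR by blast
  define \<Phi> where "\<Phi> = \<psi> -` {v} \<inter> E'"
  have "\<Phi> \<noteq> {}" using v(2) \<open>E' \<noteq> {}\<close> finE by (auto simp: \<Phi>_def)
  then obtain a0 b0 where 0: "(a0, b0) \<in> \<Phi>" by auto
  have \<Phi>_sub: "\<Phi> \<subseteq> fst ` \<Phi> \<times> snd ` \<Phi>" by force
  have fin\<Phi>: "finite \<Phi>" using finE by (simp add: \<Phi>_def)
  have \<Phi>: "a \<in> A" "b \<in> B" "(a, b) \<in> E" "(a, b) \<notin> N1" "(b, a) \<notin> N2" "\<psi> (a, b) = \<psi> (a0, b0)"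
    if "(a, b) \<in> \<Phi>" for a b
    using that 0 E by (auto simp: \<Phi>_def E'_def N2'_def)
  show ?thesis
  proof
    show "(a0, b0) \<in> E" using 0 \<Phi> by blast
    show "fst ` \<Phi> \<subseteq> A" "snd ` \<Phi> \<subseteq> B" using \<Phi>(1,2) by auto
    show "\<sigma> a b = \<sigma> a0 b0 \<and> \<tau> a b = \<tau> a0 b0" if ab: "a \<in> fst ` \<Phi>" "b \<in> snd ` \<Phi>" for a b
    proof -
      obtain a1 b1 where 1: "(a, b1) \<in> \<Phi>" "(a1, b) \<in> \<Phi>" using ab by auto
      have "\<sigma> a b = \<sigma> a1 b"
      proof -
        have "\<kappa> a = \<kappa> a1"
          using \<Phi>(6)[OF 1(1)] \<Phi>(6)[OF 1(2)] unfolding \<psi>_def by simp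
        then show ?thesis
          using \<Phi>(1)[OF 1(1)] \<Phi>(1,2,4)[OF 1(2)] unfolding N1_def by blast
      qed
      moreover have "\<tau> a b = \<tau> a b1"
      proof -
        have "\<nu> b = \<nu> b1"
          using \<Phi>(6)[OF 1(1)] \<Phi>(6)[OF 1(2)] unfolding \<psi>_def by simp
        then show ?thesis
          using \<Phi>(2)[OF 1(2)] \<Phi>(1,2,5)[OF 1(1)] unfolding N2_def by blast
      qed
      ultimately show ?thesis
        using \<Phi>(6)[OF 1(1)] \<Phi>(6)[OF 1(2)] unfolding \<psi>_def by simp
    qed
    have "card ?R = card (\<kappa> ` A) * card (\<nu> ` B) * (card T)\<^sup>2"
      by (simp add: card_cartesian_product power2_eq_square)
    then have "real (card ?R) = real (card (\<kappa> ` A)) * real (card (\<nu> ` B)) * (real (card T))\<^sup>2"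
      by simp
    also have "\<dots> \<le> K * K * (real (card T))\<^sup>2"
    proof (intro mult_right_mono mult_mono classes)
      show "0 \<le> K" using classes(1) of_nat_0_le_iff order_trans by blast
    qed auto
    finally have R_le: "real (card ?R) \<le> K\<^sup>2 * (real (card T))\<^sup>2" by (simp add: power2_eq_square)
    have "card \<Phi> \<le> card (fst ` \<Phi>) * card (snd ` \<Phi>)"
      using card_mono[OF _ \<Phi>_sub] fin\<Phi> by (simp add: card_cartesian_product)
    then have "real (card \<Phi>) \<le> real (card (fst ` \<Phi>)) * real (card (snd ` \<Phi>))"
      by (metis of_nat_le_iff of_nat_mult)
    then have "real (card ?R) * real (card \<Phi>) \<le> (K\<^sup>2 * (real (card T))\<^sup>2) *
        (real (card (fst ` \<Phi>)) * real (card (snd ` \<Phi>)))"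
      using R_le by (intro mult_mono) auto
    moreover have "real (card E') \<le> real (card ?R) * real (card \<Phi>)"
      using v(2) unfolding \<Phi>_def[symmetric] by (metis of_nat_le_iff of_nat_mult mult.commute)
    ultimately show "(\<eta> - 2 * \<delta>) * real (card A) * real (card B)
       \<le> K\<^sup>2 * (real (card T))\<^sup>2 * (real (card (fst ` \<Phi>)) * real (card (snd ` \<Phi>)))"
      using E'_ge by linarith
  qed
qed

section \<open>Meeting of two graphs read off at endpoints\<close>

text \<open>The two points of comparison are the ends of the common part of the two domains. Equality in the
  sign condition covers graphs that meet at such an end.\<close>
definition interlaced ::
  "real \<Rightarrow> real \<Rightarrow> (real \<Rightarrow> real) \<Rightarrow> real \<Rightarrow> real \<Rightarrow> (real \<Rightarrow> real) \<Rightarrow> bool" where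
  "interlaced l r f l' r' f' \<longleftrightarrow> max l l' \<le> min r r' \<and>
     (f (max l l') - f' (max l l')) * (f (min r r') - f' (min r r')) \<le> 0"

lemma interlaced_graphs_meet:
  assumes "interlaced l r f l' r' f'" "continuous_on {l..r} f" "continuous_on {l'..r'} f'"
  shows "\<exists>x\<in>{l..r} \<inter> {l'..r'}. f x = f' x"
proof -
  define u v where "u = max l l'" and "v = min r r'"
  have uv: "u \<le> v" "(f u - f' u) * (f v - f' v) \<le> 0"
    using assms(1) by (auto simp: interlaced_def u_def v_def)
  have sub: "{u..v} \<subseteq> {l..r} \<inter> {l'..r'}" by (auto simp: u_def v_def)
  show ?thesis
  proof (cases "(f u - f' u) * (f v - f' v) = 0")
    case True
    then show ?thesis using uv(1) sub by (auto simp: subset_iff)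
  next
    case False
    moreover have "continuous_on {u..v} (\<lambda>x. f x - f' x)"
      using sub by (intro continuous_intros continuous_on_subset[OF assms(2)]
        continuous_on_subset[OF assms(3)]) auto
    ultimately obtain z where "u < z" "z < v" "f z - f' z = 0"
      using zero_strictly_between[of u v "\<lambda>x. f x - f' x"] uv by force
    then show ?thesis using sub by (intro bexI[of _ z]) auto
  qed
qed

text \<open>The comparison at the left end of the common interval involves the left endpoint of one graph and its
  position with respect to the other; which of the two endpoints it is follows from the order of
  \<open>l\<close> and \<open>l'\<close>, which the positions also record. The right end is treated in the same way.\<close>
lemma interlaced_determined_by_positions:
  assumes le: "l \<le> r" "l' \<le> r'" "m \<le> n" "m' \<le> n'"
    and pos: "position l' r' f' (l, f l) = position m' n' h' (m, h m)"
      "position l' r' f' (r, f r) = position m' n' h' (n, h n)"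
      "position l r f (l', f' l') = position m n h (m', h' m')"
      "position l r f (r', f' r') = position m n h (n', h' n')"
  shows "interlaced l r f l' r' f' \<longleftrightarrow> interlaced m n h m' n' h'"
proof -
  have ord: "l < l' \<longleftrightarrow> m < m'" "l' < l \<longleftrightarrow> m' < m" "l < r' \<longleftrightarrow> m < n'" "r' < l \<longleftrightarrow> n' < m"
    "r < l' \<longleftrightarrow> n < m'" "l' < r \<longleftrightarrow> m' < n" "r < r' \<longleftrightarrow> n < n'" "r' < r \<longleftrightarrow> n' < n"
    using pos unfolding position_def prod.inject fst_conv snd_conv sgn_eq_sgn_iff by auto
  have overlap: "max l l' \<le> min r r' \<longleftrightarrow> \<not> r' < l \<and> \<not> r < l'"
    "max m m' \<le> min n n' \<longleftrightarrow> \<not> n' < m \<and> \<not> n < m'" using le by auto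
  show ?thesis
  proof (cases "max l l' \<le> min r r'")
    case False
    then have "\<not> max m m' \<le> min n n'" unfolding overlap ord .
    with False show ?thesis unfolding interlaced_def by blast
  next
    case True
    then have over: "l \<le> r'" "l' \<le> r" "max m m' \<le> min n n'" "m \<le> n'" "m' \<le> n"
      using True[unfolded overlap] True[unfolded overlap ord] unfolding overlap by auto
    have u: "sgn (f (max l l') - f' (max l l')) = sgn (h (max m m') - h' (max m m'))"
    proof (cases "l' \<le> l")
      case True
      then have "m' \<le> m" using ord by auto
      then show ?thesis using pos(1) True over by (auto simp: position_def max_def)
    next
      case False
      then have "m < m'" using ord by auto
      moreover have "sgn (f' l' - f l') = sgn (h' m' - h m')"
        using pos(3) False over \<open>m < m'\<close> by (auto simp: position_def)
      ultimately show ?thesis using False by (auto simp: max_def sgn_eq_sgn_iff)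
    qed
    have v: "sgn (f (min r r') - f' (min r r')) = sgn (h (min n n') - h' (min n n'))"
    proof (cases "r \<le> r'")
      case True
      then have "n \<le> n'" using ord by auto
      then show ?thesis using pos(2) True over by (auto simp: position_def min_def)
    next
      case False
      then have "n' < n" using ord by auto
      moreover have "sgn (f' r' - f r') = sgn (h' n' - h n')"
        using pos(4) False over \<open>n' < n\<close> by (auto simp: position_def)
      ultimately show ?thesis using False by (auto simp: min_def sgn_eq_sgn_iff)
    qed
    have "sgn ((f (max l l') - f' (max l l')) * (f (min r r') - f' (min r r'))) =
        sgn ((h (max m m') - h' (max m m')) * (h (min n n') - h' (min n n')))"
      unfolding sgn_mult u v ..
    then have "(f (max l l') - f' (max l l')) * (f (min r r') - f' (min r r')) \<le> 0 \<longleftrightarrow>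
        (h (max m m') - h' (max m m')) * (h (min n n') - h' (min n n')) \<le> 0"
      unfolding sgn_eq_sgn_iff not_less[symmetric] by blast
    then show ?thesis
      using True over(3) unfolding interlaced_def by blast
  qed
qed

lemma position_in: "position l r g p \<in> {-1,0,1} \<times> {-1,0,1} \<times> {-1,0,1}"
  by (auto simp: position_def sgn_if)

text \<open>Every graph is classified by the cells of both its endpoints, so there are of the order of
  \<open>(1 / \<eta> ^ 42)\<^sup>2\<close> classes on either side and \<open>1 / \<eta> ^ 168\<close> pairs of classes. One more factor \<open>\<eta>\<close>
  is the density of \<open>E\<close>.\<close>
lemma interlaced_rectangle:
  obtains C :: real where "C \<ge> 1"
    "\<And>(F :: 'c set) l r f l' r' f' E \<eta>.
       \<lbrakk>finite F; F \<noteq> {}; 0 < \<eta>; \<eta> \<le> 1;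
         once_meeting_graphs F l r f; once_meeting_graphs F l' r' f';
         E \<subseteq> F \<times> F; \<eta> * (real (card F))\<^sup>2 \<le> real (card E);
         \<And>a b. (a, b) \<in> E \<Longrightarrow> interlaced (l a) (r a) (f a) (l' b) (r' b) (f' b)\<rbrakk>
       \<Longrightarrow> \<exists>A B. A \<subseteq> F \<and> B \<subseteq> F \<and>
             \<eta> ^ 169 / C * real (card F) \<le> real (card A) \<and>
             \<eta> ^ 169 / C * real (card F) \<le> real (card B) \<and>
             (\<forall>a\<in>A. \<forall>b\<in>B. interlaced (l a) (r a) (f a) (l' b) (r' b) (f' b))"
proof -
  obtain C0 :: real where C0: "C0 \<ge> 1" and
    cut: "\<And>(B :: 'c set) l r g \<delta>.
       \<lbrakk>finite B; B \<noteq> {}; 0 < \<delta>; \<delta> \<le> 1; once_meeting_graphs B l r g\<rbrakk>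
       \<Longrightarrow> \<exists>desc :: real \<times> real \<Rightarrow> cell_flags \<times> nat list.
             cutting_for B l r g \<delta> desc \<and> real (card (range desc)) \<le> C0 / \<delta> ^ 42"
    using cutting_exists[where ?'b = 'c] by blast
  define Signs where "Signs = {-1, 0, 1::real} \<times> {-1, 0, 1::real} \<times> {-1, 0, 1::real}"
  define T where "T = Signs \<times> Signs"
  define C where "C = 2 * 8 ^ 168 * C0 ^ 4 * (real (card T))\<^sup>2"
  have finT: "finite T" and "T \<noteq> {}" by (auto simp: T_def Signs_def)
  then have T: "real (card T) \<ge> 1" by (simp add: Suc_le_eq card_gt_0_iff)
  have Cpos: "C \<ge> 1"
    unfolding C_def using C0 T by (intro mult_ge1_I one_le_power) auto
  show ?thesis
  proof
    show "C \<ge> 1" by (rule Cpos)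
    fix F :: "'c set" and l r l' r' :: "'c \<Rightarrow> real" and f f' :: "'c \<Rightarrow> real \<Rightarrow> real" and E and \<eta> :: real
    assume F: "finite F" "F \<noteq> {}" and \<eta>: "0 < \<eta>" "\<eta> \<le> 1"
      and graphs: "once_meeting_graphs F l r f" "once_meeting_graphs F l' r' f'"
      and E: "E \<subseteq> F \<times> F" "\<eta> * (real (card F))\<^sup>2 \<le> real (card E)"
        "\<And>a b. (a, b) \<in> E \<Longrightarrow> interlaced (l a) (r a) (f a) (l' b) (r' b) (f' b)"
    define \<delta> where "\<delta> = \<eta> / 8"
    have \<delta>: "0 < \<delta>" "\<delta> \<le> 1" using \<eta> by (simp_all add: \<delta>_def)
    obtain desc :: "real \<times> real \<Rightarrow> cell_flags \<times> nat list"
      where desc: "cutting_for F l r f \<delta> desc" "real (card (range desc)) \<le> C0 / \<delta> ^ 42"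
      using cut[OF F \<delta> graphs(1)] by blast
    obtain desc' :: "real \<times> real \<Rightarrow> cell_flags \<times> nat list"
      where desc': "cutting_for F l' r' f' \<delta> desc'" "real (card (range desc')) \<le> C0 / \<delta> ^ 42"
      using cut[OF F \<delta> graphs(2)] by blast
    define K where "K = (C0 / \<delta> ^ 42)\<^sup>2"
    define \<kappa> where "\<kappa> a = (desc' (l a, f a (l a)), desc' (r a, f a (r a)))" for a
    define \<nu> where "\<nu> b = (desc (l' b, f' b (l' b)), desc (r' b, f' b (r' b)))" for b
    let ?pos = "\<lambda>a. position (l a) (r a) (f a)" and ?pos' = "\<lambda>b. position (l' b) (r' b) (f' b)"
    define \<sigma> where "\<sigma> a b = (?pos' b (l a, f a (l a)), ?pos' b (r a, f a (r a)))" for a b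
    define \<tau> where "\<tau> a b = (?pos a (l' b, f' b (l' b)), ?pos a (r' b, f' b (r' b)))" for a b
    have two_points: "real (card ((\<lambda>a. (d (p a), d (q a))) ` F)) \<le> (C0 / \<delta> ^ 42)\<^sup>2"
      if d: "finite (range d)" "real (card (range d)) \<le> C0 / \<delta> ^ 42"
      for d :: "real \<times> real \<Rightarrow> cell_flags \<times> nat list" and p q :: "'c \<Rightarrow> real \<times> real"
    proof -
      have "card ((\<lambda>a. (d (p a), d (q a))) ` F) \<le> card (range d \<times> range d)"
        using d by (intro card_mono) auto
      then have "real (card ((\<lambda>a. (d (p a), d (q a))) ` F)) \<le> (real (card (range d)))\<^sup>2"
        by (simp add: card_cartesian_product power2_eq_square flip: of_nat_mult)
      also have "\<dots> \<le> (C0 / \<delta> ^ 42)\<^sup>2" using d by (intro power_mono) auto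
      finally show ?thesis .
    qed
    (* A graph that does not see both endpoints of a class in constant position fails at one of the
       two, whence the factor 2. *)
    have few_bad: "real (card {b \<in> F. \<exists>a'\<in>F. (d (p a'), d (q a')) = (d (p a), d (q a)) \<and>
        (position (L b) (R b) (G b) (p a'), position (L b) (R b) (G b) (q a')) \<noteq>
        (position (L b) (R b) (G b) (p a), position (L b) (R b) (G b) (q a))}) \<le> 2 * \<delta> * real (card F)"
      if d: "cutting_for F L R G \<delta> d"
      for d :: "real \<times> real \<Rightarrow> cell_flags \<times> nat list" and p q :: "'c \<Rightarrow> real \<times> real"
        and L R :: "'c \<Rightarrow> real" and G a
    proof -
      let ?X = "\<lambda>p. {b \<in> F. \<exists>p'. d p' = d p \<and>
        position (L b) (R b) (G b) p' \<noteq> position (L b) (R b) (G b) p}"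
      let ?Y = "{b \<in> F. \<exists>a'\<in>F. (d (p a'), d (q a')) = (d (p a), d (q a)) \<and>
        (position (L b) (R b) (G b) (p a'), position (L b) (R b) (G b) (q a')) \<noteq>
        (position (L b) (R b) (G b) (p a), position (L b) (R b) (G b) (q a))}"
      have "card ?Y \<le> card (?X (p a) \<union> ?X (q a))"
        using F by (intro card_mono) (auto simp del: split_paired_Ex split_paired_All)
      also have "\<dots> \<le> card (?X (p a)) + card (?X (q a))" by (rule card_Un_le)
      finally have "real (card ?Y) \<le> real (card (?X (p a))) + real (card (?X (q a)))"
        unfolding of_nat_add[symmetric] of_nat_le_iff .
      moreover have "real (card (?X p)) \<le> \<delta> * real (card F)" for p
        using d unfolding cutting_for_def by blast
      from this[of "p a"] this[of "q a"] calculation show ?thesis by linarith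
    qed
    obtain a0 b0 A B where AB: "(a0, b0) \<in> E" "A \<subseteq> F" "B \<subseteq> F"
      "\<And>a b. a \<in> A \<Longrightarrow> b \<in> B \<Longrightarrow> \<sigma> a b = \<sigma> a0 b0 \<and> \<tau> a b = \<tau> a0 b0"
      "(\<eta> - 2 * (2 * \<delta>)) * real (card F) * real (card F)
         \<le> K\<^sup>2 * (real (card T))\<^sup>2 * (real (card A) * real (card B))"
    proof (rule homogeneous_rectangle[OF F(1) F(1) F(2) F(2) E(1), of \<eta> "2 * \<delta>" \<kappa> K \<nu> T \<sigma> \<tau>])
      show "\<eta> * real (card F) * real (card F) \<le> real (card E)"
        using E(2) by (simp add: power2_eq_square mult.assoc)
      show "2 * (2 * \<delta>) < \<eta>" using \<eta> by (simp add: \<delta>_def)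
      show "real (card (\<kappa> ` F)) \<le> K" unfolding \<kappa>_def K_def
        using desc' by (intro two_points) (auto simp: cutting_for_def)
      show "real (card (\<nu> ` F)) \<le> K" unfolding \<nu>_def K_def
        using desc by (intro two_points) (auto simp: cutting_for_def)
      show "finite T" by (rule finT)
      show "\<sigma> a b \<in> T" for a b
        unfolding \<sigma>_def T_def Signs_def by (rule SigmaI; rule position_in)
      show "\<tau> a b \<in> T" for a b
        unfolding \<tau>_def T_def Signs_def by (rule SigmaI; rule position_in)
      show "real (card {b \<in> F. \<exists>a'\<in>F. \<kappa> a' = \<kappa> a \<and> \<sigma> a' b \<noteq> \<sigma> a b}) \<le> 2 * \<delta> * real (card F)" for a
        unfolding \<kappa>_def \<sigma>_def by (rule few_bad[OF desc'(1)])
      show "real (card {a \<in> F. \<exists>b'\<in>F. \<nu> b' = \<nu> b \<and> \<tau> a b' \<noteq> \<tau> a b}) \<le> 2 * \<delta> * real (card F)" for b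
        unfolding \<nu>_def \<tau>_def by (rule few_bad[OF desc(1)])
    qed blast
    have inter: "interlaced (l a) (r a) (f a) (l' b) (r' b) (f' b)" if "a \<in> A" "b \<in> B" for a b
    proof -
      have "a \<in> F" "b \<in> F" "a0 \<in> F" "b0 \<in> F" using that AB E by auto
      moreover have "\<sigma> a b = \<sigma> a0 b0" "\<tau> a b = \<tau> a0 b0" using AB(4) that by auto
      ultimately have "interlaced (l a) (r a) (f a) (l' b) (r' b) (f' b) \<longleftrightarrow>
          interlaced (l a0) (r a0) (f a0) (l' b0) (r' b0) (f' b0)"
        using graphs unfolding \<sigma>_def \<tau>_def once_meeting_graphs_def
        by (intro interlaced_determined_by_positions) auto
      then show ?thesis using E(3) AB(1) by blast
    qed
    let ?n = "real (card F)"
    have n: "?n > 0" using F by (simp add: card_gt_0_iff)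
    have card_le: "real (card A) \<le> ?n" "real (card B) \<le> ?n"
      using AB F by (simp_all add: card_mono)
    have KT: "K\<^sup>2 * (real (card T))\<^sup>2 = C / (2 * \<eta> ^ 168)"
      unfolding K_def C_def \<delta>_def by (simp add: power_divide flip: power_mult)
    have "\<eta> / 2 * ?n * ?n \<le> C / (2 * \<eta> ^ 168) * (real (card A) * real (card B))"
      using AB(5) unfolding KT by (simp add: \<delta>_def)
    then have "\<eta> / 2 * ?n * ?n * (2 * \<eta> ^ 168) \<le> C * (real (card A) * real (card B))"
      using \<eta> by (simp add: pos_le_divide_eq)
    then have main: "\<eta> ^ 169 * ?n * ?n \<le> C * (real (card A) * real (card B))"
      by (simp add: power_Suc[of \<eta> 168, simplified] mult_ac)
    have conclude: "\<eta> ^ 169 / C * ?n \<le> x"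
      if "real (card A) * real (card B) \<le> x * ?n" for x
    proof -
      have "C * (real (card A) * real (card B)) \<le> C * (x * ?n)"
        using that Cpos by (intro mult_left_mono) auto
      with main have "(\<eta> ^ 169 * ?n) * ?n \<le> (C * x) * ?n"
        unfolding mult.assoc by (rule order_trans)
      then have "\<eta> ^ 169 * ?n \<le> C * x" using n mult_le_cancel_right_pos by blast
      then show ?thesis using Cpos by (simp add: pos_divide_le_eq mult.commute)
    qed
    have "\<eta> ^ 169 / C * ?n \<le> real (card A)"
      by (rule conclude) (intro mult_left_mono card_le(2) of_nat_0_le_iff)
    moreover have "\<eta> ^ 169 / C * ?n \<le> real (card B)"
    proof (rule conclude)
      have "real (card B) * real (card A) \<le> real (card B) * ?n"
        by (intro mult_left_mono card_le(1) of_nat_0_le_iff)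
      then show "real (card A) * real (card B) \<le> real (card B) * ?n" by (simp only: mult.commute)
    qed
    ultimately show "\<exists>A B. A \<subseteq> F \<and> B \<subseteq> F \<and> \<eta> ^ 169 / C * ?n \<le> real (card A) \<and>
           \<eta> ^ 169 / C * ?n \<le> real (card B) \<and>
           (\<forall>a\<in>A. \<forall>b\<in>B. interlaced (l a) (r a) (f a) (l' b) (r' b) (f' b))"
      using AB(2,3) inter by blast
  qed
qed

section \<open>Decomposition of a curve into graphs\<close>

definition pt :: "real \<Rightarrow> real \<Rightarrow> real ^ 2" where "pt x y = vector [x, y]"

lemma pt_nth [simp]: "pt x y $ 1 = x" "pt x y $ 2 = y"
  by (simp_all add: pt_def)

lemma vec_eq_pt_iff: "p = pt x y \<longleftrightarrow> p $ 1 = x \<and> p $ 2 = y"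
  by (auto simp: vec_eq_iff forall_2)

lemma pt_inject [simp]: "pt x y = pt x' y' \<longleftrightarrow> x = x' \<and> y = y'"
  by (simp add: vec_eq_pt_iff)

lemma continuous_on_pt [continuous_intros]:
  "continuous_on S f \<Longrightarrow> continuous_on S g \<Longrightarrow> continuous_on S (\<lambda>z. pt (f z) (g z))"
proof -
  assume fg: "continuous_on S f" "continuous_on S g"
  have "continuous_on S (\<lambda>z. \<chi> i. if i = (1::2) then f z else g z)"
  proof (intro continuous_on_vec_lambda)
    show "continuous_on S (\<lambda>z. if i = 1 then f z else g z)" for i :: 2
      using fg by (cases "i = 1") auto
  qed
  moreover have "(\<chi> i. if i = (1::2) then f z else g z) = pt (f z) (g z)" for z
    by (simp add: vec_eq_pt_iff)
  ultimately show ?thesis by simp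
qed

lemma dist_pt_le: "dist (pt x y) (pt x' y') \<le> \<bar>x - x'\<bar> + \<bar>y - y'\<bar>"
  using norm_le_l1_cart[of "pt x y - pt x' y'"] by (simp add: dist_norm sum_2)

definition graph_over :: "real \<Rightarrow> real \<Rightarrow> (real \<Rightarrow> real) \<Rightarrow> (real ^ 2) set" where
  "graph_over l r f = (\<lambda>x. pt x (f x)) ` {l..r}"

text \<open>The last condition says that near an interior point of the piece there is nothing of the curve outside
  the piece. Local statements about two curves, such as a proper crossing, thereby become
  statements about two graphs.\<close>
definition monotone_piece :: "(real ^ 2) set \<Rightarrow> real \<Rightarrow> real \<Rightarrow> (real \<Rightarrow> real) \<Rightarrow> bool" where
  "monotone_piece C l r f \<longleftrightarrow> l < r \<and> continuous_on {l..r} f \<and> graph_over l r f \<subseteq> C \<and>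
     (\<forall>x\<in>{l<..<r}. pt x (f x) \<in> curve_interior C \<and>
        (\<exists>W. open W \<and> pt x (f x) \<in> W \<and> C \<inter> W \<subseteq> graph_over l r f))"

lemma monotone_piece_local:
  assumes "monotone_piece C l r f" "l < x" "x < r"
  shows "\<exists>W. open W \<and> pt x (f x) \<in> W \<and> C \<inter> W \<subseteq> graph_over l r f"
  using assms unfolding monotone_piece_def by (meson greaterThanLessThan_iff)

text \<open>By Rolle's theorem the first coordinate is injective between two consecutive vertical tangents, and
  composing the second coordinate with its continuous inverse gives the function. The rest of the
  curve is compact and, the parametrization being injective, at positive distance from each interior
  point of the arc.\<close>
lemma arc_without_vertical_tangents:
  assumes par: "parametrizes a b \<phi> C"
    and der: "\<And>u. u \<in> {a..b} \<Longrightarrow> (\<phi> has_vector_derivative \<phi>' u) (at u within {a..b})"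
    and s: "a \<le> s" "s < s'" "s' \<le> b"
    and nonvert: "\<And>u. u \<in> {s<..<s'} \<Longrightarrow> \<phi>' u $ 1 \<noteq> 0"
  shows "\<exists>l r f. monotone_piece C l r f \<and> graph_over l r f = \<phi> ` {s..s'}"
proof -
  have inj: "inj_on \<phi> {a..b}" and C: "C = \<phi> ` {a..b}" using par by (auto simp: parametrizes_def)
  have cont\<phi>: "continuous_on {a..b} \<phi>"
    unfolding continuous_on_eq_continuous_within
    using der has_vector_derivative_continuous by blast
  define X where "X u = \<phi> u $ 1" for u
  have contX: "continuous_on {s..s'} X" unfolding X_def using s
    by (intro continuous_intros continuous_on_subset[OF cont\<phi>]) auto
  have derX: "((\<lambda>u. X u) has_derivative (\<lambda>h. h * \<phi>' u $ 1)) (at u)" if "u \<in> {s<..<s'}" for u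
  proof -
    have "u \<in> interior {a..b}" using that s by auto
    then have "(\<phi> has_vector_derivative \<phi>' u) (at u)"
      using der[of u] at_within_interior[of u "{a..b}"] interior_subset[of "{a..b}"] by auto
    then have "((\<lambda>u. \<phi> u $ 1) has_derivative (\<lambda>h. (h *\<^sub>R \<phi>' u) $ 1)) (at u)"
      unfolding has_vector_derivative_def by (rule bounded_linear.has_derivative[OF bounded_linear_vec_nth])
    then show ?thesis by (simp add: X_def)
  qed
  have injX: "inj_on X {s..s'}"
  proof (rule linorder_inj_onI)
    fix u v assume uv: "u < v" "u \<in> {s..s'}" "v \<in> {s..s'}"
    show "X u \<noteq> X v"
    proof
      assume "X u = X v"
      then have "\<exists>z. u < z \<and> z < v \<and> (\<lambda>h. h * \<phi>' z $ 1) = (\<lambda>h. 0)"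
        using uv by (intro Rolle_deriv[of u v X "\<lambda>z h. h * \<phi>' z $ 1"] continuous_on_subset[OF contX] derX) auto
      then show False using nonvert uv by (auto simp: fun_eq_iff)
    qed
  qed auto
  define l r where "l = min (X s) (X s')" and "r = max (X s) (X s')"
  have "X s \<noteq> X s'" using injX s by (auto dest: inj_onD)
  then have "l < r" by (auto simp: l_def r_def)
  have img: "X ` {s..s'} = {l..r}"
  proof
    show "X ` {s..s'} \<subseteq> {l..r}"
    proof
      fix x assume "x \<in> X ` {s..s'}"
      then obtain u where u: "u \<in> {s..s'}" "x = X u" by auto
      show "x \<in> {l..r}"
        using continuous_inj_imp_mono[of s u s' X] contX injX u
        by (cases "u = s \<or> u = s'") (auto simp: l_def r_def)
    qed
    have con: "connected (X ` {s..s'})" by (intro connected_continuous_image contX) auto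
    have "X s \<in> X ` {s..s'}" "X s' \<in> X ` {s..s'}" using s by auto
    then show "{l..r} \<subseteq> X ` {s..s'}"
      using connected_contains_Icc[OF con] by (auto simp: l_def r_def min_def max_def)
  qed
  define \<psi> where "\<psi> = the_inv_into {s..s'} X"
  have \<psi>: "\<psi> (X u) = u" if "u \<in> {s..s'}" for u
    using the_inv_into_f_f[OF injX that] by (simp add: \<psi>_def)
  have cont\<psi>: "continuous_on {l..r} \<psi>"
    using continuous_on_inv_into[OF contX _ injX] by (simp add: img \<psi>_def)
  have \<psi>_in: "\<psi> x \<in> {s..s'}" "X (\<psi> x) = x" if "x \<in> {l..r}" for x
    using that \<psi> unfolding img[symmetric] by auto
  define f where "f x = \<phi> (\<psi> x) $ 2" for x
  have contf: "continuous_on {l..r} f"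
    unfolding f_def
  proof (intro continuous_intros continuous_on_compose2[OF cont\<phi> cont\<psi>])
    show "\<psi> ` {l..r} \<subseteq> {a..b}" using \<psi>_in(1) s by fastforce
  qed
  have on_graph: "pt x (f x) = \<phi> (\<psi> x)" if "x \<in> {l..r}" for x
    using \<psi>_in(2)[OF that] by (auto simp: f_def X_def vec_eq_iff forall_2)
  have graph: "graph_over l r f = \<phi> ` {s..s'}"
  proof -
    have "graph_over l r f = \<phi> ` \<psi> ` {l..r}" using on_graph by (auto simp: graph_over_def image_iff)
    also have "\<psi> ` {l..r} = {s..s'}" unfolding img[symmetric] image_image using \<psi> by simp
    finally show ?thesis .
  qed
  have "monotone_piece C l r f"
    unfolding monotone_piece_def
  proof (intro conjI ballI)
    show "graph_over l r f \<subseteq> C" unfolding graph C using s by auto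
    fix x assume x: "x \<in> {l<..<r}"
    define u where "u = \<psi> x"
    have u: "u \<in> {s..s'}" "X u = x" "pt x (f x) = \<phi> u"
      using \<psi>_in[of x] on_graph[of x] x by (auto simp: u_def)
    have "x \<noteq> X s" "x \<noteq> X s'" using x by (auto simp: l_def r_def min_def max_def split: if_splits)
    then have u': "u \<in> {s<..<s'}" using u(1,2) by (cases "u = s \<or> u = s'") auto
    have "\<phi> u \<in> \<phi> ` {a<..<b}" using u' s by auto
    then show "pt x (f x) \<in> curve_interior C"
      unfolding u(3) curve_interior_def using par by blast
    let ?rest = "\<phi> ` ({a..s} \<union> {s'..b})"
    have "compact ?rest"
      using s by (intro compact_continuous_image continuous_on_subset[OF cont\<phi>] compact_Un) auto
    then have "open (- ?rest)" by (simp add: compact_imp_closed open_Compl)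
    moreover have "pt x (f x) \<in> - ?rest"
      unfolding u(3) using inj_onD[OF inj] u' s by force
    moreover have "C \<inter> - ?rest \<subseteq> graph_over l r f"
      unfolding graph C by force
    ultimately show "\<exists>W. open W \<and> pt x (f x) \<in> W \<and> C \<inter> W \<subseteq> graph_over l r f" by blast
  qed (use \<open>l < r\<close> contf in auto)
  with graph show ?thesis by blast
qed

text \<open>Each of the at most \<open>t - 1\<close> vertical tangents in the interior, and the initial endpoint, starts an
  arc that runs to the next break. A curve with fewer than \<open>t\<close> arcs lists its first one repeatedly,
  so that all curves have pieces with the same indices.\<close>
lemma monotone_decomposition:
  assumes "t_monotone t C" "t \<ge> 1"
  obtains l r f where "\<And>i. i < t \<Longrightarrow> monotone_piece C (l i) (r i) (f i)"
    "C = (\<Union>i<t. graph_over (l i) (r i) (f i))"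
proof -
  obtain a b \<phi> where par: "parametrizes a b \<phi> C"
    using assms by (auto simp: t_monotone_def curve_def)
  then obtain \<phi>' where ab: "a < b" and inj: "inj_on \<phi> {a..b}" and C: "\<phi> ` {a..b} = C"
    and der: "\<And>u. u \<in> {a..b} \<Longrightarrow> (\<phi> has_vector_derivative \<phi>' u) (at u within {a..b})"
    unfolding parametrizes_def by blast
  define V where "V = {u \<in> {a<..<b}. \<phi>' u $ 1 = 0}"
  let ?P = "{p \<in> curve_interior C. vertical_tangent_at C p}"
  have sub: "\<phi> ` V \<subseteq> ?P"
  proof
    fix p assume "p \<in> \<phi> ` V"
    then obtain u where u: "u \<in> {a<..<b}" "\<phi>' u $ 1 = 0" "p = \<phi> u" by (auto simp: V_def)
    have "p \<in> \<phi> ` {a<..<b}" using u by auto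
    then have "p \<in> curve_interior C" using par unfolding curve_interior_def by blast
    moreover have "vector_derivative \<phi> (at u within {a..b}) = \<phi>' u"
      using der[of u] u ab vector_derivative_within_cbox[of a b u \<phi> "\<phi>' u"] by auto
    then have "parametrizes a b \<phi> C \<and> u \<in> {a..b} \<and> \<phi> u = p \<and>
        vector_derivative \<phi> (at u within {a..b}) $ 1 = 0" using par u by simp
    then have "vertical_tangent_at C p"
      unfolding vertical_tangent_at_def by blast
    ultimately show "p \<in> ?P" by simp
  qed
  have "inj_on \<phi> V" using inj by (rule inj_on_subset) (auto simp: V_def)
  then have finV: "finite V" and "card V \<le> t - 1"
    using sub assms(1) finite_imageD[OF finite_subset[OF sub]] card_mono[OF _ sub]
    by (auto simp: t_monotone_def card_image)
  define I where "I = insert a V"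
  have I: "finite I" "card I \<le> t" "I \<noteq> {}"
    using finV \<open>card V \<le> t - 1\<close> assms(2) card_insert_le_m1[of t V a] by (auto simp: I_def)
  define nxt where "nxt s = Min {v \<in> insert b V. s < v}" for s
  have nxt: "nxt s \<in> insert b V" "s < nxt s" "\<And>v. v \<in> insert b V \<Longrightarrow> s < v \<Longrightarrow> nxt s \<le> v"
    if "s \<in> I" for s
  proof -
    have fin: "finite {v \<in> insert b V. s < v}" using finV by simp
    have "b \<in> {v \<in> insert b V. s < v}" using that ab by (auto simp: I_def V_def)
    then have "nxt s \<in> {v \<in> insert b V. s < v}" unfolding nxt_def using fin by (intro Min_in) auto
    then show "nxt s \<in> insert b V" "s < nxt s" by auto
    show "nxt s \<le> v" if "v \<in> insert b V" "s < v" for v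
      unfolding nxt_def using that fin by (intro Min_le) auto
  qed
  have nxt_le: "nxt s \<le> b" and I_ge: "a \<le> s" if "s \<in> I" for s
    using nxt(1)[OF that] ab that by (auto simp: V_def I_def)
  have "\<exists>l r f. monotone_piece C l r f \<and> graph_over l r f = \<phi> ` {s..nxt s}" if "s \<in> I" for s
  proof (rule arc_without_vertical_tangents[OF par der])
    show "\<phi>' u $ 1 \<noteq> 0" if "u \<in> {s<..<nxt s}" for u
      using that nxt(3)[OF \<open>s \<in> I\<close>, of u] I_ge[OF \<open>s \<in> I\<close>] nxt_le[OF \<open>s \<in> I\<close>] by (force simp: V_def)
  qed (use that nxt I_ge nxt_le in auto)
  then obtain l r f where lrf: "\<And>s. s \<in> I \<Longrightarrow> monotone_piece C (l s) (r s) (f s)"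
    "\<And>s. s \<in> I \<Longrightarrow> graph_over (l s) (r s) (f s) = \<phi> ` {s..nxt s}" by metis
  have cover: "C = (\<Union>s\<in>I. \<phi> ` {s..nxt s})"
  proof
    show "(\<Union>s\<in>I. \<phi> ` {s..nxt s}) \<subseteq> C"
      unfolding C[symmetric] using I_ge nxt_le by fastforce
    show "C \<subseteq> (\<Union>s\<in>I. \<phi> ` {s..nxt s})"
    proof
      fix p assume "p \<in> C"
      then obtain u where u: "u \<in> {a..b}" "p = \<phi> u" using C by auto
      define s where "s = Max {v \<in> I. v \<le> u}"
      have fin: "finite {v \<in> I. v \<le> u}" using I by simp
      have "a \<in> {v \<in> I. v \<le> u}" using u by (auto simp: I_def)
      then have s: "s \<in> {v \<in> I. v \<le> u}" unfolding s_def using fin by (intro Max_in) auto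
      have "u \<le> nxt s"
      proof (rule ccontr)
        assume "\<not> u \<le> nxt s"
        then have "nxt s \<in> {v \<in> I. v \<le> u}" using nxt(1)[of s] s u by (auto simp: I_def)
        then have "nxt s \<le> s" using fin by (simp add: s_def)
        then show False using nxt(2)[of s] s by auto
      qed
      then have "p \<in> \<phi> ` {s..nxt s}" using s u(2) by auto
      then show "p \<in> (\<Union>s\<in>I. \<phi> ` {s..nxt s})" using s by blast
    qed
  qed
  obtain e where e: "e ` {..<t} = I"
  proof -
    obtain h where h: "bij_betw h {0..<card I} I" using ex_bij_betw_nat_finite[OF I(1)] by blast
    have "(\<lambda>i. if i < card I then h i else a) ` {..<t} = I"
    proof
      show "(\<lambda>i. if i < card I then h i else a) ` {..<t} \<subseteq> I"
        using bij_betw_imp_surj_on[OF h] by (auto simp: I_def)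
      show "I \<subseteq> (\<lambda>i. if i < card I then h i else a) ` {..<t}"
      proof
        fix v assume "v \<in> I"
        then have "v \<in> h ` {0..<card I}" using bij_betw_imp_surj_on[OF h] by simp
        then obtain i where "i < card I" "v = h i" by auto
        then show "v \<in> (\<lambda>i. if i < card I then h i else a) ` {..<t}"
          using I(2) by (intro image_eqI[of _ _ i]) auto
      qed
    qed
    then show ?thesis using that by blast
  qed
  show ?thesis
  proof
    show "monotone_piece C (l (e i)) (r (e i)) (f (e i))" if "i < t" for i
      using lrf(1) e that by blast
    have "C = (\<Union>s\<in>e ` {..<t}. graph_over (l s) (r s) (f s))"
      unfolding e using cover lrf(2) by auto
    then show "C = (\<Union>i<t. graph_over (l (e i)) (r (e i)) (f (e i)))" by simp
  qed
qed

section \<open>Contacts without crossing\<close>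

text \<open>A thin strip just above the graph of \<open>f\<close> near the contact point \<open>p\<close> is connected and disjoint from
  \<open>A\<close>, so the chart of a proper crossing maps it to one side of the axis that represents \<open>A\<close>. But
  apart from \<open>p\<close> the strip contains all points of \<open>B\<close> near \<open>p\<close>, and these reach both sides.\<close>
lemma graph_not_properly_crossed_by_touching:
  assumes A: "monotone_piece A l r f" and B: "monotone_piece B l' r' g"
    and x0: "x0 \<in> {l<..<r} \<inter> {l'<..<r'}" "f x0 = g x0"
    and below: "\<And>x. x \<in> {l<..<r} \<inter> {l'<..<r'} \<Longrightarrow> x \<noteq> x0 \<Longrightarrow> f x < g x"
  shows "\<not> properly_cross_at A B (pt x0 (f x0))"
proof
  define p where "p = pt x0 (f x0)"
  assume "properly_cross_at A B (pt x0 (f x0))"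
  then obtain U V :: "(real ^ 2) set" and h k where UV: "open U" "open V" "p \<in> U"
    and hom: "homeomorphism U V h k" and h0: "h p = 0"
    and hA: "h ` (A \<inter> U) = {v \<in> V. v $ 2 = 0}" and hB: "h ` (B \<inter> U) = {v \<in> V. v $ 1 = 0}"
    unfolding properly_cross_at_def p_def[symmetric] by (elim exE conjE) (rule that; assumption)
  have hk: "\<And>q. q \<in> U \<Longrightarrow> h q \<in> V \<and> k (h q) = q" "\<And>v. v \<in> V \<Longrightarrow> k v \<in> U \<and> h (k v) = v"
    and conth: "continuous_on U h" and contk: "continuous_on V k"
    using hom by (auto simp: homeomorphism_def)
  have x0l: "l < x0" "x0 < r" "l' < x0" "x0 < r'" using x0(1) by auto
  have p_eq: "p = pt x0 (g x0)" using x0(2) by (simp add: p_def)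
  obtain WA where WA: "open WA" "p \<in> WA" "A \<inter> WA \<subseteq> graph_over l r f"
    using monotone_piece_local[OF A x0l(1,2)] unfolding p_def by blast
  obtain WB where WB: "open WB" "p \<in> WB" "B \<inter> WB \<subseteq> graph_over l' r' g"
    using monotone_piece_local[OF B x0l(3,4)] unfolding p_eq[symmetric] by blast
  define M where "M = U \<inter> WA \<inter> WB"
  have "open M" "p \<in> M" using UV WA WB by (auto simp: M_def)
  then obtain e where e: "e > 0" "ball p e \<subseteq> M" using open_contains_ball by blast
  have cf: "isCont f x0" and cg: "isCont g x0"
    using A B x0 unfolding monotone_piece_def by (auto intro!: continuous_on_interior[of "{_.._}"])
  have lims: "(f \<longlongrightarrow> f x0) (nhds x0)" "(g \<longlongrightarrow> g x0) (nhds x0)"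
    using cf cg by (simp_all add: isCont_def tendsto_at_iff_tendsto_nhds)
  have e3: "0 < e / 3" using e(1) by simp
  have ef: "\<forall>\<^sub>F x in nhds x0. \<bar>f x - f x0\<bar> < e / 3"
    using tendstoD[OF lims(1) e3] unfolding dist_real_def .
  have "((\<lambda>x. g x - f x) \<longlongrightarrow> 0) (nhds x0)"
    using tendsto_diff[OF lims(2,1)] x0(2) by simp
  then have eg: "\<forall>\<^sub>F x in nhds x0. \<bar>g x - f x\<bar> < e / 3"
    using tendstoD[OF _ e3] unfolding dist_real_def by fastforce
  have ei: "\<forall>\<^sub>F x in nhds x0. x \<in> {l<..<r} \<inter> {l'<..<r'}"
    using x0(1) by (intro eventually_nhds_in_open) auto
  have "\<forall>\<^sub>F x in nhds x0. \<bar>f x - f x0\<bar> < e / 3 \<and> \<bar>g x - f x\<bar> < e / 3 \<and> x \<in> {l<..<r} \<inter> {l'<..<r'}"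
    using ef eg ei by eventually_elim auto
  then obtain \<rho>0 where \<rho>0: "\<rho>0 > 0" "\<And>x. \<bar>x - x0\<bar> < \<rho>0 \<Longrightarrow>
      \<bar>f x - f x0\<bar> < e / 3 \<and> \<bar>g x - f x\<bar> < e / 3 \<and> x \<in> {l<..<r} \<inter> {l'<..<r'}"
    unfolding eventually_nhds_metric dist_real_def by blast
  (* With this radius the strip lies in M, where the chart lives and where A and B are the two
     graphs. *)
  define \<rho> where "\<rho> = min \<rho>0 (e / 3)"
  have \<rho>: "\<rho> > 0" "\<rho> \<le> \<rho>0" "\<rho> \<le> e / 3" using \<rho>0(1) e(1) by (auto simp: \<rho>_def)
  define strip where "strip = {x0 - \<rho><..<x0 + \<rho>} \<times> {0<..<e / 3}"
  define Z where "Z = (\<lambda>(x, z). pt x (f x + z)) ` strip"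
  have ZM: "Z \<subseteq> M"
  proof
    fix q assume "q \<in> Z"
    then obtain x z where q: "q = pt x (f x + z)" "\<bar>x - x0\<bar> < \<rho>" "0 < z" "z < e / 3"
      by (auto simp: Z_def strip_def abs_less_iff)
    have "dist q p \<le> \<bar>x - x0\<bar> + \<bar>f x + z - f x0\<bar>"
      unfolding q(1) p_def by (rule dist_pt_le)
    also have "\<dots> < e" using q \<rho> \<rho>0(2)[of x] by linarith
    finally show "q \<in> M" using e(2) by (auto simp: dist_commute)
  qed
  have "connected strip" unfolding strip_def
    by (intro convex_connected convex_Times) auto
  moreover have "continuous_on strip (\<lambda>w. pt (fst w) (f (fst w) + snd w))"
  proof (intro continuous_intros)
    have "fst ` strip \<subseteq> {l..r}"
    proof
      fix x assume "x \<in> fst ` strip"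
      then have "\<bar>x - x0\<bar> < \<rho>0" using \<rho> by (auto simp: strip_def)
      then show "x \<in> {l..r}" using \<rho>0(2)[of x] by simp
    qed
    then show "continuous_on strip (\<lambda>w. f (fst w))"
      using A continuous_on_fst[OF continuous_on_id] unfolding monotone_piece_def
      by (blast intro: continuous_on_compose2[of "{l..r}" f strip fst])
  qed
  ultimately have "connected Z"
    unfolding Z_def case_prod_beta by (intro connected_continuous_image)
  then have "connected ((\<lambda>q. h q $ 2) ` Z)"
    using ZM by (intro connected_continuous_image continuous_intros continuous_on_subset[OF conth])
      (auto simp: M_def)
  moreover have "0 \<notin> (\<lambda>q. h q $ 2) ` Z"
  proof
    assume "0 \<in> (\<lambda>q. h q $ 2) ` Z"
    then obtain q where q: "q \<in> Z" "h q $ 2 = 0" by auto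
    have qM: "q \<in> M" using q ZM by auto
    then have "q \<in> U" by (simp add: M_def)
    then have "h q \<in> h ` (A \<inter> U)" unfolding hA using q(2) hk(1) by simp
    then obtain q' where q': "q' \<in> A" "q' \<in> U" "h q = h q'" by blast
    then have "q = q'" using hk(1)[OF \<open>q \<in> U\<close>] hk(1)[OF q'(2)] by metis
    then have "q \<in> graph_over l r f" using WA(3) qM q'(1) unfolding M_def by blast
    then obtain x where "q = pt x (f x)" by (auto simp: graph_over_def)
    moreover obtain x' z where "q = pt x' (f x' + z)" "z > 0"
      using q(1) by (auto simp: Z_def strip_def)
    ultimately show False by auto
  qed
  moreover have "\<exists>q\<in>Z. h q = pt 0 y" if y: "pt 0 y \<in> V" "y \<noteq> 0"
      "k (pt 0 y) \<in> M" "\<bar>k (pt 0 y) $ 1 - x0\<bar> < \<rho>" for y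
  proof -
    let ?q = "k (pt 0 y)"
    have "pt 0 y \<in> h ` (B \<inter> U)" unfolding hB using y by simp
    then obtain q' where q': "q' \<in> B" "q' \<in> U" "pt 0 y = h q'" by blast
    then have "?q = q'" using hk(1)[OF q'(2)] by metis
    then have "?q \<in> graph_over l' r' g" using WB(3) y(3) q'(1) unfolding M_def by blast
    then obtain x where x: "?q = pt x (g x)" unfolding graph_over_def by blast
    then have near: "\<bar>x - x0\<bar> < \<rho>" using y(4) by simp
    have "h ?q = pt 0 y" using hk(2)[OF y(1)] by blast
    moreover have "pt 0 y \<noteq> 0" using y(2) by (metis pt_nth(2) zero_index)
    ultimately have "?q \<noteq> p" using h0 by metis
    then have "x \<noteq> x0" using x unfolding p_eq by metis
    then have "f x < g x" "\<bar>g x - f x\<bar> < e / 3" using below \<rho>0(2)[of x] near \<rho> by auto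
    then have "?q \<in> Z" unfolding x Z_def strip_def using near
      by (intro image_eqI[of _ _ "(x, g x - f x)"]) (auto simp: abs_less_iff)
    then show ?thesis using hk(2)[OF y(1)] by blast
  qed
  moreover have "\<exists>\<tau>>0. \<forall>y\<in>{\<tau>, -\<tau>}. pt 0 y \<in> V \<and> k (pt 0 y) \<in> M \<and> \<bar>k (pt 0 y) $ 1 - x0\<bar> < \<rho>"
  proof -
    define N where "N = M \<inter> (\<lambda>q. q $ 1) -` {x0 - \<rho><..<x0 + \<rho>}"
    have "open N" unfolding N_def
      by (intro open_Int \<open>open M\<close> open_vimage continuous_intros open_greaterThanLessThan)
    then have "open (V \<inter> k -` N)" by (intro continuous_open_preimage contk UV)
    moreover have "0 \<in> V \<inter> k -` N"
      using hk(1)[OF UV(3)] h0 \<open>p \<in> M\<close> \<rho> by (auto simp: N_def p_def)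
    ultimately obtain \<tau> where \<tau>: "\<tau> > 0" "ball 0 \<tau> \<subseteq> V \<inter> k -` N"
      using open_contains_ball by blast
    have near0: "k (pt 0 y) \<in> N \<and> pt 0 y \<in> V" if "\<bar>y\<bar> < \<tau>" for y
    proof -
      have "(0 :: real ^ 2) = pt 0 0" by (simp add: vec_eq_pt_iff)
      then have "dist 0 (pt 0 y) \<le> \<bar>y\<bar>" using dist_pt_le[of 0 0 0 y] by simp
      then have "pt 0 y \<in> ball 0 \<tau>" using that by simp
      then show ?thesis using \<tau>(2) by blast
    qed
    show ?thesis
    proof (intro exI[of _ "\<tau> / 2"] conjI ballI)
      fix y assume "y \<in> {\<tau> / 2, - (\<tau> / 2)}"
      then have y: "\<bar>y\<bar> < \<tau>" using \<tau>(1) by auto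
      show "pt 0 y \<in> V" "k (pt 0 y) \<in> M" "\<bar>k (pt 0 y) $ 1 - x0\<bar> < \<rho>"
        using near0[OF y] by (auto simp: N_def abs_less_iff)
    qed (use \<tau>(1) in simp)
  qed
  ultimately obtain \<tau> where \<tau>: "\<tau> > 0" and ex: "\<exists>q\<in>Z. h q = pt 0 \<tau>" "\<exists>q\<in>Z. h q = pt 0 (- \<tau>)"
    by (metis insertCI less_irrefl neg_equal_0_iff_equal)
  then have "\<tau> \<in> (\<lambda>q. h q $ 2) ` Z" "- \<tau> \<in> (\<lambda>q. h q $ 2) ` Z"
    by (metis image_eqI pt_nth(2))+
  then have "{-\<tau>..\<tau>} \<subseteq> (\<lambda>q. h q $ 2) ` Z"
    using connected_contains_Icc[OF \<open>connected ((\<lambda>q. h q $ 2) ` Z)\<close>] by blast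
  moreover have "0 \<in> {-\<tau>..\<tau>}" using \<tau> by simp
  ultimately show False using \<open>0 \<notin> (\<lambda>q. h q $ 2) ` Z\<close> by blast
qed

text \<open>A second change of order would produce a second common point, so \<open>f\<close> lies below \<open>g\<close> on both sides
  of the common point and the graphs touch there.\<close>
lemma no_one_sided_contact:
  assumes A: "monotone_piece A l r f" and B: "monotone_piece B l' r' g"
    and single: "\<And>x y. x \<in> {l..r} \<inter> {l'..r'} \<Longrightarrow> y \<in> {l..r} \<inter> {l'..r'} \<Longrightarrow> f x = g x \<Longrightarrow> f y = g y \<Longrightarrow> x = y"
    and cross: "\<And>p. p \<in> curve_interior A \<inter> curve_interior B \<Longrightarrow> properly_cross_at A B p"
    and x0: "x0 \<in> {l..r} \<inter> {l'..r'}" "f x0 = g x0"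
    and ends: "f (max l l') < g (max l l')" "f (min r r') < g (min r r')"
  shows False
proof -
  define u v where "u = max l l'" and "v = min r r'"
  have "x0 \<noteq> u" "x0 \<noteq> v" using ends x0(2) by (auto simp: u_def v_def)
  then have x0uv: "u < x0" "x0 < v" using x0(1) by (auto simp: u_def v_def)
  then have x0in: "x0 \<in> {l<..<r} \<inter> {l'<..<r'}" by (auto simp: u_def v_def)
  have sub: "{u..v} \<subseteq> {l..r} \<inter> {l'..r'}" by (auto simp: u_def v_def)
  have cont: "continuous_on {u..v} (\<lambda>x. f x - g x)"
    using A B sub unfolding monotone_piece_def
    by (intro continuous_intros) (blast intro: continuous_on_subset)+
  have below: "f x < g x" if x: "x \<in> {l<..<r} \<inter> {l'<..<r'}" "x \<noteq> x0" for x
  proof (rule ccontr)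
    assume "\<not> f x < g x"
    have xuv: "u < x" "x < v" using x by (auto simp: u_def v_def)
    have "f x \<noteq> g x" using single[OF _ x0(1) _ x0(2), of x] xuv sub x(2) by force
    with \<open>\<not> f x < g x\<close> have pos: "f x - g x > 0" by simp
    have eu: "f u - g u < 0" and ev: "f v - g v < 0" using ends by (simp_all add: u_def v_def)
    have "\<exists>z. f z = g z \<and> z \<noteq> x0 \<and> u \<le> z \<and> z \<le> v"
    proof (cases "x < x0")
      case True
      obtain z where "u < z" "z < x" "f z - g z = 0"
        using zero_strictly_between[of u x "\<lambda>x. f x - g x"] continuous_on_subset[OF cont, of "{u..x}"]
          xuv mult_neg_pos[OF eu pos] by auto
      then show ?thesis using True xuv by (intro exI[of _ z]) auto
    next
      case False
      obtain z where "x < z" "z < v" "f z - g z = 0"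
        using zero_strictly_between[of x v "\<lambda>x. f x - g x"] continuous_on_subset[OF cont, of "{x..v}"]
          xuv mult_pos_neg[OF pos ev] by auto
      then show ?thesis using False xuv by (intro exI[of _ z]) auto
    qed
    then obtain z where z: "f z = g z" "z \<noteq> x0" "z \<in> {u..v}" by auto
    then show False using single[OF _ x0(1) z(1) x0(2)] sub by blast
  qed
  have "pt x0 (f x0) \<in> curve_interior A"
    using A x0in unfolding monotone_piece_def by blast
  moreover have "pt x0 (f x0) \<in> curve_interior B"
    unfolding x0(2) using B x0in unfolding monotone_piece_def by blast
  ultimately have "properly_cross_at A B (pt x0 (f x0))" using cross by blast
  then show False using graph_not_properly_crossed_by_touching[OF A B x0in x0(2) below] by blast
qed

lemma meeting_pieces_interlaced:
  assumes F: "simple_family F" "A \<in> F" "B \<in> F" "A \<noteq> B"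
    and A: "monotone_piece A l r f" and B: "monotone_piece B l' r' g"
    and x0: "x0 \<in> {l..r} \<inter> {l'..r'}" "f x0 = g x0"
  shows "interlaced l r f l' r' g"
proof (rule ccontr)
  assume not: "\<not> interlaced l r f l' r' g"
  have on: "pt x (f x) \<in> A \<inter> B" if "x \<in> {l..r} \<inter> {l'..r'}" "f x = g x" for x
    using that A B unfolding monotone_piece_def graph_over_def by force
  have single: "x = y" if "x \<in> {l..r} \<inter> {l'..r'}" "y \<in> {l..r} \<inter> {l'..r'}" "f x = g x" "f y = g y" for x y
  proof -
    have "pt x (f x) = pt y (f y)"
      using F on[OF that(1,3)] on[OF that(2,4)] unfolding simple_family_def by blast
    then show ?thesis by simp
  qed
  have crossA: "properly_cross_at A B p" if "p \<in> curve_interior A \<inter> curve_interior B" for p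
    using F that unfolding simple_family_def by blast
  have crossB: "properly_cross_at B A p" if "p \<in> curve_interior B \<inter> curve_interior A" for p
    using F that unfolding simple_family_def by metis
  have "max l l' \<le> min r r'" using x0(1) by auto
  with not have "0 < (f (max l l') - g (max l l')) * (f (min r r') - g (min r r'))"
    unfolding interlaced_def by auto
  then consider "f (max l l') < g (max l l')" "f (min r r') < g (min r r')"
    | "g (max l' l) < f (max l' l)" "g (min r' r) < f (min r' r)"
    unfolding zero_less_mult_iff max.commute[of l' l] min.commute[of r' r] by auto
  then show False
  proof cases
    case 1
    then show False using no_one_sided_contact[OF A B single crossA x0] by blast
  next
    case 2
    (* Both orders of the two curves are covered by the definition of a simple family, so the
       lower graph may be taken first. *)
    have "x0 \<in> {l'..r'} \<inter> {l..r}" "g x0 = f x0" using x0 by auto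
    then show False using no_one_sided_contact[OF B A _ crossB, of x0] single 2
      by (metis (no_types, lifting) Int_commute)
  qed
qed

section \<open>Counting pairs and conclusion\<close>

text \<open>The members of \<open>Q\<close> are unordered pairs, and each of them is the image of an ordered pair that meets in
  some pieces \<open>i\<close> and \<open>j\<close>. Averaging over the \<open>t\<^sup>2\<close> choices of \<open>(i, j)\<close> gives the bound.\<close>
lemma ordered_pairs_of_pieces:
  fixes P :: "nat \<Rightarrow> 'c \<Rightarrow> 'p set"
  assumes fin: "finite F" and t: "t \<ge> 1"
    and many: "\<epsilon> * (real (card F))\<^sup>2 \<le> real (card Q)"
    and Q: "\<And>q. q \<in> Q \<Longrightarrow> \<exists>A\<in>F. \<exists>B\<in>F. q = {A, B} \<and> A \<noteq> B \<and> (\<exists>i<t. \<exists>j<t. P i A \<inter> P j B \<noteq> {})"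
  obtains i j where "i < t" "j < t"
    "\<epsilon> / (real t)\<^sup>2 * (real (card F))\<^sup>2 \<le>
       real (card {(A, B). A \<in> F \<and> B \<in> F \<and> A \<noteq> B \<and> P i A \<inter> P j B \<noteq> {}})"
proof -
  define E where "E i j = {(A, B). A \<in> F \<and> B \<in> F \<and> A \<noteq> B \<and> P i A \<inter> P j B \<noteq> {}}" for i j
  have finE: "finite (E i j)" for i j
    by (rule finite_subset[of _ "F \<times> F"]) (use fin in \<open>auto simp: E_def\<close>)
  let ?T = "{..<t} \<times> {..<t}"
  have "Q \<subseteq> (\<Union>ij\<in>?T. (\<lambda>(A, B). {A, B}) ` E (fst ij) (snd ij))"
  proof
    fix q assume "q \<in> Q"
    from Q[OF this] obtain A B i j where "A \<in> F" "B \<in> F" "q = {A, B}" "A \<noteq> B" "i < t" "j < t"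
      "P i A \<inter> P j B \<noteq> {}" by blast
    then have "(A, B) \<in> E i j" "(i, j) \<in> ?T" by (auto simp: E_def)
    then show "q \<in> (\<Union>ij\<in>?T. (\<lambda>(A, B). {A, B}) ` E (fst ij) (snd ij))"
      using \<open>q = {A, B}\<close> by force
  qed
  then have "card Q \<le> card (\<Union>ij\<in>?T. (\<lambda>(A, B). {A, B}) ` E (fst ij) (snd ij))"
    using finE by (intro card_mono) auto
  also have "\<dots> \<le> (\<Sum>ij\<in>?T. card ((\<lambda>(A, B). {A, B}) ` E (fst ij) (snd ij)))"
    by (intro card_UN_le) auto
  also have "\<dots> \<le> (\<Sum>ij\<in>?T. card (E (fst ij) (snd ij)))"
    by (intro sum_mono card_image_le finE)
  finally have le: "real (card Q) \<le> (\<Sum>ij\<in>?T. real (card (E (fst ij) (snd ij))))"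
    unfolding of_nat_sum[symmetric] of_nat_le_iff .
  have "\<exists>ij\<in>?T. \<epsilon> / (real t)\<^sup>2 * (real (card F))\<^sup>2 \<le> real (card (E (fst ij) (snd ij)))"
  proof (rule ccontr)
    assume "\<not> ?thesis"
    then have "(\<Sum>ij\<in>?T. real (card (E (fst ij) (snd ij)))) < (\<Sum>ij\<in>?T. \<epsilon> / (real t)\<^sup>2 * (real (card F))\<^sup>2)"
      using t by (intro sum_strict_mono) (auto simp: not_le lessThan_empty_iff)
    also have "\<dots> = (real t)\<^sup>2 * (\<epsilon> / (real t)\<^sup>2 * (real (card F))\<^sup>2)"
      by (simp add: card_cartesian_product power2_eq_square)
    also have "\<dots> = \<epsilon> * (real (card F))\<^sup>2" using t by simp
    finally show False using le many by linarith
  qed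
  then show ?thesis using that unfolding E_def by auto
qed

lemma intersecting_pairs_density_le_half:
  assumes "finite F" "F \<noteq> {}" "\<epsilon> * (real (card F))\<^sup>2 \<le> real (card (intersecting_pairs F))"
  shows "\<epsilon> \<le> 1 / 2"
proof -
  let ?n = "real (card F)"
  have "intersecting_pairs F \<subseteq> {S. S \<subseteq> F \<and> card S = 2}"
    by (auto simp: intersecting_pairs_def card_2_iff)
  then have "card (intersecting_pairs F) \<le> card F choose 2"
    using card_mono[of "{S. S \<subseteq> F \<and> card S = 2}"] n_subsets[OF assms(1), of 2] assms(1) by auto
  also have "\<dots> = card F * (card F - 1) div 2" by (rule choose_two)
  finally have "2 * card (intersecting_pairs F) \<le> card F * card F"
    using mult_le_mono2[OF diff_le_self, of "card F" "card F" 1] by linarith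
  then have "2 * real (card (intersecting_pairs F)) \<le> ?n\<^sup>2"
    unfolding power2_eq_square by (metis of_nat_le_iff of_nat_mult of_nat_numeral)
  then have "(2 * \<epsilon>) * ?n\<^sup>2 \<le> 1 * ?n\<^sup>2" using assms(3) by simp
  moreover have "?n\<^sup>2 > 0" using assms by (simp add: card_gt_0_iff)
  ultimately have "2 * \<epsilon> \<le> 1" using mult_le_cancel_right_pos by blast
  then show ?thesis by simp
qed

text \<open>Raising the exponent by \<open>log 2 (1 / \<kappa>)\<close> gains a factor of at most \<open>\<kappa>\<close>, since \<open>\<epsilon>\<close> is at most one half.\<close>
lemma constant_absorbed_into_exponent:
  fixes \<epsilon> \<kappa> :: real
  assumes "0 < \<epsilon>" "\<epsilon> \<le> 1 / 2" "0 < \<kappa>" "\<kappa> \<le> 1"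
  shows "\<epsilon> powr (real k + log 2 (1 / \<kappa>)) \<le> \<epsilon> ^ k * \<kappa>"
proof -
  have "log 2 (1 / \<kappa>) \<ge> 0" using assms by simp
  then have "\<epsilon> powr log 2 (1 / \<kappa>) \<le> (1 / 2) powr log 2 (1 / \<kappa>)"
    using assms by (intro powr_mono2) auto
  also have "\<dots> = \<kappa>" using assms by (simp add: powr_divide)
  finally show ?thesis using assms by (simp add: powr_add powr_realpow mult_left_mono)
qed

theorem theorem1p3:
  fixes t :: nat
  assumes "t \<ge> 1"
  shows "\<exists>c::real. \<forall>\<epsilon>::real. \<forall>n::nat. \<forall>F :: (real ^ 2) set set.
    \<epsilon> > 0 \<and> n > 0 \<and>
    finite F \<and> card F = n \<and> (\<forall>C\<in>F. t_monotone t C) \<and> simple_family F \<and>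
    real (card (intersecting_pairs F)) \<ge> \<epsilon> * (real n)\<^sup>2 \<longrightarrow>
    (\<exists>F1 F2. F1 \<subseteq> F \<and> F2 \<subseteq> F \<and>
      real (card F1) \<ge> \<epsilon> powr c * real n \<and>
      real (card F2) \<ge> \<epsilon> powr c * real n \<and>
      (\<forall>A\<in>F1. \<forall>B\<in>F2. curves_intersect A B))"
proof -
  obtain K :: real where K: "K \<ge> 1" and rectangle:
    "\<And>(F :: (real ^ 2) set set) l r f l' r' f' E \<eta>.
       \<lbrakk>finite F; F \<noteq> {}; 0 < \<eta>; \<eta> \<le> 1;
         once_meeting_graphs F l r f; once_meeting_graphs F l' r' f';
         E \<subseteq> F \<times> F; \<eta> * (real (card F))\<^sup>2 \<le> real (card E);
         \<And>a b. (a, b) \<in> E \<Longrightarrow> interlaced (l a) (r a) (f a) (l' b) (r' b) (f' b)\<rbrakk>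
       \<Longrightarrow> \<exists>A B. A \<subseteq> F \<and> B \<subseteq> F \<and>
             \<eta> ^ 169 / K * real (card F) \<le> real (card A) \<and>
             \<eta> ^ 169 / K * real (card F) \<le> real (card B) \<and>
             (\<forall>a\<in>A. \<forall>b\<in>B. interlaced (l a) (r a) (f a) (l' b) (r' b) (f' b))"
    using interlaced_rectangle[where ?'c = "(real ^ 2) set"] by blast
  (* With \<eta> = \<epsilon> / t^2, the bound \<eta> ^ 169 / K of the rectangle is \<epsilon> ^ 169 * \<kappa>. *)
  define D where "D = ((real t)\<^sup>2) ^ 169 * K"
  have D: "1 \<le> D" unfolding D_def using K assms by (intro mult_ge1_I one_le_power) auto
  define \<kappa> where "\<kappa> = 1 / D"
  have \<kappa>: "0 < \<kappa>" "\<kappa> \<le> 1" using D by (auto simp: \<kappa>_def)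
  define c where "c = real 169 + log 2 (1 / \<kappa>)"
  have rectangle_of_curves: "\<exists>F1 F2. F1 \<subseteq> F \<and> F2 \<subseteq> F \<and> real (card F1) \<ge> \<epsilon> powr c * real (card F) \<and>
      real (card F2) \<ge> \<epsilon> powr c * real (card F) \<and> (\<forall>A\<in>F1. \<forall>B\<in>F2. curves_intersect A B)"
    if \<epsilon>: "\<epsilon> > 0" and F: "finite F" "F \<noteq> {}" and mono: "\<forall>C\<in>F. t_monotone t C"
      and simple: "simple_family F"
      and dense: "real (card (intersecting_pairs F)) \<ge> \<epsilon> * (real (card F))\<^sup>2"
    for \<epsilon> :: real and F :: "(real ^ 2) set set"
  proof -
    have half: "\<epsilon> \<le> 1 / 2" using intersecting_pairs_density_le_half[OF F dense] .
    define decomposes where "decomposes C l r f \<longleftrightarrow> (\<forall>i<t. monotone_piece C (l i) (r i) (f i)) \<and>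
        C = (\<Union>i<t. graph_over (l i) (r i) (f i))" for C l r f
    have "\<exists>l r f. decomposes C l r f" if "C \<in> F" for C
      using mono that unfolding decomposes_def
      by (blast intro: monotone_decomposition[OF _ assms, of C])
    then obtain l r f where lrf: "\<And>C. C \<in> F \<Longrightarrow> decomposes C (l C) (r C) (f C)" by metis
    have piece: "monotone_piece C (l C i) (r C i) (f C i)" if "C \<in> F" "i < t" for C i
      using lrf[OF that(1)] that(2) unfolding decomposes_def by blast
    have cover: "\<exists>i<t. p \<in> graph_over (l C i) (r C i) (f C i)" if "C \<in> F" "p \<in> C" for C p
      using lrf[OF that(1)] that(2) unfolding decomposes_def by blast
    let ?P = "\<lambda>i C. graph_over (l C i) (r C i) (f C i)"
    obtain i j where ij: "i < t" "j < t" and many: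
      "\<epsilon> / (real t)\<^sup>2 * (real (card F))\<^sup>2 \<le>
         real (card {(A, B). A \<in> F \<and> B \<in> F \<and> A \<noteq> B \<and> ?P i A \<inter> ?P j B \<noteq> {}})"
    proof (rule ordered_pairs_of_pieces[OF F(1) assms dense])
      fix q assume "q \<in> intersecting_pairs F"
      then obtain A B where AB: "q = {A, B}" "A \<in> F" "B \<in> F" "A \<noteq> B" "A \<inter> B \<noteq> {}"
        unfolding intersecting_pairs_def curves_intersect_def by blast
      then obtain p where p: "p \<in> A" "p \<in> B" by blast
      obtain i where "i < t" "p \<in> ?P i A" using cover[OF AB(2) p(1)] by blast
      moreover obtain j where "j < t" "p \<in> ?P j B" using cover[OF AB(3) p(2)] by blast
      ultimately show "\<exists>A\<in>F. \<exists>B\<in>F. q = {A, B} \<and> A \<noteq> B \<and> (\<exists>i<t. \<exists>j<t. ?P i A \<inter> ?P j B \<noteq> {})"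
        using AB by blast
    qed
    define E where "E = {(A, B). A \<in> F \<and> B \<in> F \<and> A \<noteq> B \<and> ?P i A \<inter> ?P j B \<noteq> {}}"
    define \<eta> where "\<eta> = \<epsilon> / (real t)\<^sup>2"
    have t2: "1 \<le> (real t)\<^sup>2" using assms by simp
    have "0 < (real t)\<^sup>2" using t2 by linarith
    then have \<eta>: "0 < \<eta>" "\<eta> \<le> 1"
      unfolding \<eta>_def pos_divide_le_eq[OF \<open>0 < (real t)\<^sup>2\<close>] using \<epsilon> half t2 by (simp, linarith)
    have pieces: "l C k \<le> r C k \<and> continuous_on {l C k..r C k} (f C k)" if "k < t" "C \<in> F" for C k
      using piece[OF that(2,1)] unfolding monotone_piece_def by simp
    have graphs: "once_meeting_graphs F (\<lambda>C. l C k) (\<lambda>C. r C k) (\<lambda>C. f C k)" if k: "k < t" for k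
      unfolding once_meeting_graphs_def
    proof (intro conjI ballI impI)
      show "l C k \<le> r C k" "continuous_on {l C k..r C k} (f C k)" if "C \<in> F" for C
        using pieces[OF k that] by auto
      fix A B x y
      assume AB: "A \<in> F" "B \<in> F" "A \<noteq> B"
        and xy: "x \<in> {l A k..r A k} \<inter> {l B k..r B k}" "y \<in> {l A k..r A k} \<inter> {l B k..r B k}"
        and eq: "f A k x = f B k x" "f A k y = f B k y"
      have on: "pt z (f A k z) \<in> A \<inter> B"
        if "z \<in> {l A k..r A k} \<inter> {l B k..r B k}" "f A k z = f B k z" for z
      proof -
        have "pt z (f A k z) \<in> ?P k A" using that(1) unfolding graph_over_def by blast
        moreover have "pt z (f B k z) \<in> ?P k B" using that(1) unfolding graph_over_def by blast
        ultimately show ?thesis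
          using piece[OF AB(1) k] piece[OF AB(2) k] that(2) unfolding monotone_piece_def by auto
      qed
      have "pt x (f A k x) = pt y (f A k y)"
        using simple AB on[OF xy(1) eq(1)] on[OF xy(2) eq(2)] unfolding simple_family_def by blast
      then show "x = y" by simp
    qed
    have "interlaced (l A i) (r A i) (f A i) (l B j) (r B j) (f B j)" if "(A, B) \<in> E" for A B
    proof -
      have AB: "A \<in> F" "B \<in> F" "A \<noteq> B" "?P i A \<inter> ?P j B \<noteq> {}" using that by (auto simp: E_def)
      from AB(4) obtain x y where "x \<in> {l A i..r A i}" "y \<in> {l B j..r B j}"
        "pt x (f A i x) = pt y (f B j y)" unfolding graph_over_def by blast
      then have "x \<in> {l A i..r A i} \<inter> {l B j..r B j}" "f A i x = f B j x" by auto
      then show ?thesis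
        by (rule meeting_pieces_interlaced[OF simple AB(1-3) piece[OF AB(1) ij(1)] piece[OF AB(2) ij(2)]])
    qed
    moreover have "E \<subseteq> F \<times> F" by (auto simp: E_def)
    moreover have "\<eta> * (real (card F))\<^sup>2 \<le> real (card E)"
      using many by (simp add: E_def \<eta>_def)
    ultimately have "\<exists>F1 F2. F1 \<subseteq> F \<and> F2 \<subseteq> F \<and>
        \<eta> ^ 169 / K * real (card F) \<le> real (card F1) \<and>
        \<eta> ^ 169 / K * real (card F) \<le> real (card F2) \<and>
        (\<forall>A\<in>F1. \<forall>B\<in>F2. interlaced (l A i) (r A i) (f A i) (l B j) (r B j) (f B j))"
      by (intro rectangle[OF F \<eta> graphs[OF ij(1)] graphs[OF ij(2)]])
    then obtain F1 F2 where F12: "F1 \<subseteq> F" "F2 \<subseteq> F" "\<eta> ^ 169 / K * real (card F) \<le> real (card F1)"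
      "\<eta> ^ 169 / K * real (card F) \<le> real (card F2)"
      "\<And>A B. A \<in> F1 \<Longrightarrow> B \<in> F2 \<Longrightarrow> interlaced (l A i) (r A i) (f A i) (l B j) (r B j) (f B j)"
      by blast
    have "\<epsilon> powr c \<le> \<epsilon> ^ 169 * \<kappa>"
      unfolding c_def by (rule constant_absorbed_into_exponent[OF \<epsilon> half \<kappa>])
    also have "\<dots> = \<eta> ^ 169 / K" by (simp add: \<eta>_def \<kappa>_def D_def power_divide)
    finally have "\<epsilon> powr c * real (card F) \<le> \<eta> ^ 169 / K * real (card F)"
      by (intro mult_right_mono) auto
    moreover have "curves_intersect A B" if mem: "A \<in> F1" "B \<in> F2" for A B
    proof -
      have AB: "A \<in> F" "B \<in> F" using mem F12 by auto
      obtain x where x: "x \<in> {l A i..r A i} \<inter> {l B j..r B j}" "f A i x = f B j x"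
        using interlaced_graphs_meet[OF F12(5)[OF mem]] pieces[OF ij(1) AB(1)] pieces[OF ij(2) AB(2)]
        by blast
      have "pt x (f A i x) \<in> ?P i A" "pt x (f B j x) \<in> ?P j B"
        using x(1) unfolding graph_over_def by blast+
      then have "pt x (f A i x) \<in> ?P i A \<inter> ?P j B" using x(2) by simp
      then show ?thesis
        using piece[OF AB(1) ij(1)] piece[OF AB(2) ij(2)]
        unfolding curves_intersect_def monotone_piece_def by blast
    qed
    ultimately show ?thesis using F12(1-4) by (intro exI[of _ F1] exI[of _ F2]) auto
  qed
  show ?thesis
  proof (intro exI[of _ c] allI impI, elim conjE)
    fix \<epsilon> :: real and n and F :: "(real ^ 2) set set"
    assume F: "\<epsilon> > 0" "n > 0" "finite F" "card F = n" "\<forall>C\<in>F. t_monotone t C" "simple_family F"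
      "real (card (intersecting_pairs F)) \<ge> \<epsilon> * (real n)\<^sup>2"
    then have "F \<noteq> {}" by auto
    then show "\<exists>F1 F2. F1 \<subseteq> F \<and> F2 \<subseteq> F \<and> real (card F1) \<ge> \<epsilon> powr c * real n \<and>
        real (card F2) \<ge> \<epsilon> powr c * real n \<and> (\<forall>A\<in>F1. \<forall>B\<in>F2. curves_intersect A B)"
      using rectangle_of_curves[of \<epsilon> F] F by blast
  qed
qed

end
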